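(* Consider affine type $A_2^{(1)}$. For a dominant monomial $$M=\prod_{k\in\mathbb Z}\left(Y_{\mathsf D^k(1,2)}^{a_k}\,Y_{\mathsf D^k(2,1)}^{b_k}\,Y_{\mathsf D^k(1,0)}^{c_k}\right)$$ ($a_k,b_k,c_k\in\mathbb Z_{\ge0}$, almost all zero) one has $$\mathsf R_1([V(M)])=[V(M')]\qquad\text{and}\qquad\mathsf R_2([V(M)])=[V(M'')],$$ where $$M'=\prod_{k\in\mathbb Z}\left(Y_{\mathsf D^k(1,2)}^{\min\{a_k,c_k\}}\,Y_{\mathsf D^k(2,1)}^{b_k+\max\{a_k-c_k,0\}}\,Y_{\mathsf D^k(1,0)}^{b_{k-1}+\max\{c_{k-1}-a_{k-1},0\}}\right),$$ $$M''=\prod_{k\in\mathbb Z}\left(Y_{\mathsf D^k(1,2)}^{a_{k-1}+c_k-\min\{a_{k-1},b_k\}}\,Y_{\mathsf D^k(2,1)}^{\min\{a_{k-1},b_k\}}\,Y_{\mathsf D^k(1,0)}^{b_k+c_k-\min\{a_{k-1},b_k\}}\right).$$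
   Context: Let $I_0=\{1,2\}$, $\mathsf D(i,a)=(3-i,a+3)$, and $\mathscr S_{\mathbb Z}=\{(i,a)\in I_0\times\mathbb Z:a-i\equiv1\bmod2\}=\{\mathsf D^k(1,2),\mathsf D^k(2,1),\mathsf D^k(1,0):k\in\mathbb Z\}$. For a dominant monomial $M$ in the $Y_{i,a}$, $(i,a)\in\mathscr S_{\mathbb Z}$, $V(M)$ denotes the finite-dimensional simple module over the quantum affine algebra $U_q'(\mathfrak g)$ of type $A_2^{(1)}$ with Drinfeld polynomials $(\prod_p(1-q^pz)^{u_{i,p}})_{i\in I_0}$, where $u_{i,p}$ is the exponent of $Y_{i,p}$ in $M$. $\mathcal B(\mathfrak g)=\{[V(M)]\}$ is the set of isomorphism classes of simple modules of the Hernandez–Leclerc category $\mathscr C^0$ (the smallest full subcategory of finite-dimensional integrable $U'_q(\mathfrak g)$-modules containing all $V(Y_{i,a})$, $(i,a)\in\mathscr S_{\mathbb Z}$, and stable under subquotients, extensions and tensor products). Multisegment realization of $B(\infty)$ in type $A_2$: $\mathsf{MS}_2$ is the set of multisegments $\mathbf m=a[2]+b[1,2]+c[1]$ with $a,b,c\in\mathbb Z_{\ge0}$, with weight $\mathrm{wt}(\mathbf m)=-(a\alpha_2+b(\alpha_1+\alpha_2)+c\alpha_1)$ and crystal structure: - $\tilde f_1(\mathbf m)=\mathbf m+[1]$ if $a\le c$, $\mathbf m-[2]+[1,2]$ if $a>c$; $\tilde e_1(\mathbf m)=0$ if $b=0,a\ge c$; $\mathbf m-[1,2]+[2]$ if $b>0,a\ge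 c$; $\mathbf m-[1]$ if $a<c$. - $\tilde f_2(\mathbf m)=\mathbf m+[2]$; $\tilde e_2(\mathbf m)=0$ if $a=0$, $\mathbf m-[2]$ if $a>0$. - $\tilde f_1^*(\mathbf m)=\mathbf m+[1]$; $\tilde e_1^*(\mathbf m)=0$ if $c=0$, $\mathbf m-[1]$ if $c>0$. - $\tilde f_2^*(\mathbf m)=\mathbf m+[2]$ if $a\ge c$, $\mathbf m-[1]+[1,2]$ if $a<c$; $\tilde e_2^*(\mathbf m)=0$ if $b=0,a\le c$; $\mathbf m-[1,2]+[1]$ if $b>0,a\le c$; $\mathbf m-[2]$ if $a>c$. - $\varepsilon_1(\mathbf m)=b+\max(c-a,0)$, $\varepsilon_2(\mathbf m)=a$, $\varepsilon_1^*(\mathbf m)=c$, $\varepsilon_2^*(\mathbf m)=b+\max(a-c,0)$, $\varphi_i^*=\varepsilon_i^*+\langle h_i,\mathrm{wt}\rangle$. For $\varepsilon_i(\mathbf m)=0$ the Saito reflection is $\mathrm S_i(\mathbf m)=\tilde f_i^{\varphi_i^*(\mathbf m)}\tilde e_i^{*\,\varepsilon_i^*(\mathbf m)}(\mathbf m)$; for arbitrary $\mathbf m$, $\widetilde{\mathrm S}_i(\mathbf m)=\mathrm S_i(\tilde e_i^{\varepsilon_i(\mathbf m)}(\mathbf m))$. The extended crystal is $\widehat{\mathsf{MS}}_2=\{(\mathbf m_k)_{k\in\mathbb Z}:\mathbf m_k\in\mathsf{MS}_2,\ \mathbf m_k=\emptyset\text{ for almost all }k\}$, and $R_i((\mathbf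 m_k)_k)=(\mathbf m_k')_k$ with $\mathbf m_k'=\tilde f_i^{*\,\varepsilon_i(\mathbf m_{k-1})}(\widetilde{\mathrm S}_i(\mathbf m_k))$. The extended crystal isomorphism $\phi:\widehat{\mathsf{MS}}_2\to\mathcal B(\mathfrak g)$ sends $(a_k[2]+b_k[1,2]+c_k[1])_k$ to $[V(\prod_kY_{\mathsf D^k(1,2)}^{a_k}Y_{\mathsf D^k(2,1)}^{b_k}Y_{\mathsf D^k(1,0)}^{c_k})]$, and $\mathsf R_i=\phi\circ R_i\circ\phi^{-1}$ on $\mathcal B(\mathfrak g)$. *)

theory Defs
  imports
    "HOL-Computational_Algebra.Polynomial"
    "HOL-Library.Poly_Mapping"
    "Jordan_Normal_Form.VS_Connect"
begin

section \<open>Finite-dimensional modules over the quantum affine algebra of type \<open>A\<^sub>2\<^sup>(\<^sup>1\<^sup>)\<close>\<close>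

definition I0 :: "int set" where
  "I0 = {1, 2}"

definition cartan :: "int \<Rightarrow> int \<Rightarrow> int" where
  "cartan i j = (if i = j then 2 else - 1)"

text \<open>
  Integrable finite-dimensional modules have level zero, so they are modules over the quotient of
  the quantum affine algebra by the relation that the central element is \<open>1\<close>. We use Drinfeld's
  loop presentation of this quotient, in which Drinfeld polynomials are defined: the generators are
  \<open>x\<^sup>\<plusminus>\<close> with indices \<open>i \<in> I\<^sub>0\<close>, \<open>r \<in> \<int>\<close>, and the Fourier modes of
  \<open>\<psi>\<^sup>\<plusminus>(z) = K\<^sup>\<plusminus>\<^sup>1 exp (\<plusminus>(q - q\<^sup>-\<^sup>1) \<Sum>\<^sub>s\<^sub>>\<^sub>0 h\<^sub>\<plusminus>\<^sub>s z\<^sup>\<plusminus>\<^sup>s)\<close>.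

  A module structure on \<open>k\<^sup>n\<close> is given by matrices: \<open>xop V e i r\<close> and \<open>psi V e i r\<close> are the
  actions of \<open>x\<close> and of the coefficient of \<open>z\<^sup>r\<close> in \<open>\<psi>(z)\<close>, for the sign \<open>e \<in> {1, -1}\<close>.
  Every finite-dimensional module is isomorphic to one of this form. The values of the record
  fields at other arguments \<open>e\<close>, \<open>i\<close> are irrelevant.
\<close>

record 'k loop_mod =
  mdim :: nat
  xop :: "int \<Rightarrow> int \<Rightarrow> int \<Rightarrow> 'k mat"
  psi :: "int \<Rightarrow> int \<Rightarrow> int \<Rightarrow> 'k mat"

definition signs :: "int set" where
  "signs = {1, - 1}"

definition serre_term :: "'k::field \<Rightarrow> 'k mat \<Rightarrow> 'k mat \<Rightarrow> 'k mat \<Rightarrow> 'k mat" where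
  "serre_term q A A' B = A * A' * B - (q + inverse q) \<cdot>\<^sub>m (A * B * A') + B * A * A'"

text \<open>
  With \<open>b = e a\<^sub>i\<^sub>j\<close>, \<open>x(z) = \<Sum> x\<^sub>r z\<^sup>r\<close> and \<open>\<psi>(z) = \<Sum> \<psi>\<^sub>r z\<^sup>r\<close>, the fifth and sixth clauses are the
  coefficients of \<open>z\<^sup>r\<^sup>+\<^sup>1 w\<^sup>s\<^sup>+\<^sup>1\<close> in
  \<open>(w - q\<^sup>b z) \<psi>\<^sub>i(z) x\<^sub>j(w) = (q\<^sup>b w - z) x\<^sub>j(w) \<psi>\<^sub>i(z)\<close> and in the same identity with \<open>x\<^sub>i(z)\<close> in place
  of \<open>\<psi>\<^sub>i(z)\<close>. At the boundary values \<open>r = -1\<close> (for \<open>\<psi>\<^sup>+\<close>) and \<open>r = 0\<close> (for \<open>\<psi>\<^sup>-\<close>) the fifth clause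
  says \<open>K\<^sub>i x\<^sub>j K\<^sub>i\<^sup>-\<^sup>1 = q\<^sup>b x\<^sub>j\<close>.
\<close>

definition loop_module :: "'k::field \<Rightarrow> 'k loop_mod \<Rightarrow> bool" where
  "loop_module q V \<longleftrightarrow>
    (let n = mdim V; x = xop V; \<psi> = psi V in
      (\<forall>e\<in>signs. \<forall>i\<in>I0. \<forall>r. x e i r \<in> carrier_mat n n \<and> \<psi> e i r \<in> carrier_mat n n) \<and>
      (\<forall>e\<in>signs. \<forall>i\<in>I0. \<forall>r. e * r < 0 \<longrightarrow> \<psi> e i r = 0\<^sub>m n n) \<and>
      (\<forall>i\<in>I0. \<psi> 1 i 0 * \<psi> (- 1) i 0 = 1\<^sub>m n) \<and>
      (\<forall>e\<in>signs. \<forall>e'\<in>signs. \<forall>i\<in>I0. \<forall>j\<in>I0. \<forall>r s. \<psi> e i r * \<psi> e' j s = \<psi> e' j s * \<psi> e i r) \<and>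
      (\<forall>e'\<in>signs. \<forall>e\<in>signs. \<forall>i\<in>I0. \<forall>j\<in>I0. \<forall>r s.
        \<psi> e' i (r + 1) * x e j s - (q powi (e * cartan i j)) \<cdot>\<^sub>m (\<psi> e' i r * x e j (s + 1))
        = (q powi (e * cartan i j)) \<cdot>\<^sub>m (x e j s * \<psi> e' i (r + 1)) - x e j (s + 1) * \<psi> e' i r) \<and>
      (\<forall>e\<in>signs. \<forall>i\<in>I0. \<forall>j\<in>I0. \<forall>r s.
        x e i (r + 1) * x e j s - (q powi (e * cartan i j)) \<cdot>\<^sub>m (x e j s * x e i (r + 1))
        = (q powi (e * cartan i j)) \<cdot>\<^sub>m (x e i r * x e j (s + 1)) - x e j (s + 1) * x e i r) \<and>
      (\<forall>i\<in>I0. \<forall>j\<in>I0. \<forall>r s.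
        x 1 i r * x (- 1) j s - x (- 1) j s * x 1 i r
        = (if i = j then inverse (q - inverse q) \<cdot>\<^sub>m (\<psi> 1 i (r + s) - \<psi> (- 1) i (r + s))
           else 0\<^sub>m n n)) \<and>
      (\<forall>e\<in>signs. \<forall>i\<in>I0. \<forall>j\<in>I0. i \<noteq> j \<longrightarrow> (\<forall>r r' s.
        serre_term q (x e i r) (x e i r') (x e j s) + serre_term q (x e i r') (x e i r) (x e j s)
        = 0\<^sub>m n n)))"

text \<open>
  Integrability of a finite-dimensional module: it is the direct sum of its weight spaces, where
  \<open>K\<^sub>i = \<psi>\<^sub>i\<^sub>,\<^sub>0\<^sup>+\<close> acts on a space of weight \<open>\<mu>\<close> by \<open>q\<close> to the power \<open>\<langle>h\<^sub>i, \<mu>\<rangle>\<close>. Local nilpotency of the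
  Chevalley generators is then automatic.
\<close>

definition integrable_mod :: "'k::field \<Rightarrow> 'k loop_mod \<Rightarrow> bool" where
  "integrable_mod q V \<longleftrightarrow>
    (\<exists>P Q (\<mu> :: nat \<Rightarrow> int \<Rightarrow> int). \<forall>i\<in>I0.
      similar_mat_wit (psi V 1 i 0)
        (mat (mdim V) (mdim V) (\<lambda>(s, t). if s = t then q powi (\<mu> s i) else 0)) P Q)"

definition simple_module :: "'k::field loop_mod \<Rightarrow> bool" where
  "simple_module V \<longleftrightarrow> mdim V > 0 \<and>
    (\<forall>U. subspace class_ring U (module_vec TYPE('k) (mdim V)) \<and>
         (\<forall>e\<in>signs. \<forall>i\<in>I0. \<forall>r. \<forall>u\<in>U. xop V e i r *\<^sub>v u \<in> U \<and> psi V e i r *\<^sub>v u \<in> U)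
       \<longrightarrow> U = {0\<^sub>v (mdim V)} \<or> U = carrier_vec (mdim V))"

definition iso_mod :: "'k::field loop_mod \<Rightarrow> 'k loop_mod \<Rightarrow> bool" where
  "iso_mod V W \<longleftrightarrow> mdim V = mdim W \<and>
    (\<exists>P \<in> carrier_mat (mdim V) (mdim V). invertible_mat P \<and>
      (\<forall>e\<in>signs. \<forall>i\<in>I0. \<forall>r. P * xop V e i r = xop W e i r * P \<and> P * psi V e i r = psi W e i r * P))"

definition iso_class :: "'k::field \<Rightarrow> 'k loop_mod \<Rightarrow> 'k loop_mod set" where
  "iso_class q V = {W. loop_module q W \<and> iso_mod V W}"


section \<open>Dominant monomials and the modules \<open>V(M)\<close>\<close>

definition D :: "int \<times> int \<Rightarrow> int \<times> int" where
  "D = (\<lambda>(i, a). (3 - i, a + 3))"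

definition Dpow :: "int \<Rightarrow> int \<times> int \<Rightarrow> int \<times> int" where
  "Dpow k = (if 0 \<le> k then D ^^ nat k else inv_into UNIV D ^^ nat (- k))"

definition S_Z :: "(int \<times> int) set" where
  "S_Z = {(i, a). i \<in> I0 \<and> (a - i) mod 2 = 1}"

text \<open>
  Monomials in the commuting variables \<open>Y\<^sub>i\<^sub>,\<^sub>a\<close> with nonnegative exponents are represented by their
  exponent functions, so that products of monomials become sums.
\<close>

type_synonym monomial = "(int \<times> int) \<Rightarrow>\<^sub>0 nat"

definition Ypow :: "int \<times> int \<Rightarrow> nat \<Rightarrow> monomial" where
  "Ypow p u = Poly_Mapping.single p u"

definition Y_product :: "(int \<Rightarrow> nat) \<Rightarrow> (int \<Rightarrow> nat) \<Rightarrow> (int \<Rightarrow> nat) \<Rightarrow> monomial" where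
  "Y_product a b c =
    Sum_any (\<lambda>k. Ypow (Dpow k (1, 2)) (a k) + Ypow (Dpow k (2, 1)) (b k) + Ypow (Dpow k (1, 0)) (c k))"

definition drinfeld_poly :: "'k::field \<Rightarrow> monomial \<Rightarrow> int \<Rightarrow> 'k poly" where
  "drinfeld_poly q M i =
    (\<Prod>p | Poly_Mapping.lookup M (i, p) \<noteq> 0. [:1, - (q powi p):] ^ Poly_Mapping.lookup M (i, p))"

text \<open>
  \<open>V\<close> has a highest \<open>\<ell>\<close>-weight vector on which \<open>\<psi>\<^sub>i\<^sup>\<plusminus>(z)\<close> acts by the expansion at \<open>z = 0\<close>,
  resp. \<open>z = \<infinity>\<close>, of \<open>q\<^bsup>deg P\<^esup> P(q\<^sup>-\<^sup>1 z) / P(q z)\<close> with \<open>P\<close> the \<open>i\<close>-th polynomial. Multiplied by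
  \<open>P(q z)\<close> and read coefficientwise (at \<open>z\<^sup>m\<close>), both conditions take the same form.
\<close>

definition has_drinfeld_polys :: "'k::field \<Rightarrow> (int \<Rightarrow> 'k poly) \<Rightarrow> 'k loop_mod \<Rightarrow> bool" where
  "has_drinfeld_polys q P V \<longleftrightarrow>
    (\<exists>v \<in> carrier_vec (mdim V). v \<noteq> 0\<^sub>v (mdim V) \<and>
      (\<forall>i\<in>I0. \<forall>r. xop V 1 i r *\<^sub>v v = 0\<^sub>v (mdim V)) \<and>
      (\<exists>\<kappa>. (\<forall>e\<in>signs. \<forall>i\<in>I0. \<forall>r. psi V e i r *\<^sub>v v = \<kappa> e i r \<cdot>\<^sub>v v) \<and>
        (\<forall>e\<in>signs. \<forall>i\<in>I0. \<forall>m.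
          (\<Sum>n\<le>degree (P i). coeff (P i) n * q ^ n * \<kappa> e i (m - int n))
          = q ^ degree (P i) * (if 0 \<le> m then coeff (P i) (nat m) * q powi (- m) else 0))))"

definition is_V :: "'k::field \<Rightarrow> monomial \<Rightarrow> 'k loop_mod \<Rightarrow> bool" where
  "is_V q M V \<longleftrightarrow> loop_module q V \<and> integrable_mod q V \<and> simple_module V \<and>
    has_drinfeld_polys q (drinfeld_poly q M) V"

text \<open>
  The isomorphism class \<open>[V(M)]\<close>. A simple module is determined by its Drinfeld polynomials up to
  isomorphism, so the union has a single member.
\<close>

definition V_class :: "'k::field \<Rightarrow> monomial \<Rightarrow> 'k loop_mod set" where
  "V_class q M = \<Union> {iso_class q V | V. is_V q M V}"

definition B_g :: "'k::field \<Rightarrow> 'k loop_mod set set" where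
  "B_g q = {iso_class q V | V M. Poly_Mapping.keys M \<subseteq> S_Z \<and> is_V q M V}"


section \<open>Multisegments and the extended crystal\<close>

text \<open>The triple \<open>(a, b, c)\<close> stands for the multisegment \<open>a[2] + b[1,2] + c[1]\<close>. The value \<open>None\<close>
  is the crystal element \<open>0\<close>.\<close>

type_synonym ms = "nat \<times> nat \<times> nat"

fun f_op :: "int \<Rightarrow> ms \<Rightarrow> ms" where
  "f_op i (a, b, c) =
    (if i = 1 then (if a \<le> c then (a, b, c + 1) else (a - 1, b + 1, c)) else (a + 1, b, c))"

fun e_op :: "int \<Rightarrow> ms \<Rightarrow> ms option" where
  "e_op i (a, b, c) =
    (if i = 1 then
       (if a < c then Some (a, b, c - 1)
        else if b > 0 then Some (a + 1, b - 1, c) else None)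
     else (if a > 0 then Some (a - 1, b, c) else None))"

fun f_star :: "int \<Rightarrow> ms \<Rightarrow> ms" where
  "f_star i (a, b, c) =
    (if i = 1 then (a, b, c + 1)
     else (if a \<ge> c then (a + 1, b, c) else (a, b + 1, c - 1)))"

fun e_star :: "int \<Rightarrow> ms \<Rightarrow> ms option" where
  "e_star i (a, b, c) =
    (if i = 1 then (if c > 0 then Some (a, b, c - 1) else None)
     else (if a > c then Some (a - 1, b, c)
           else if b > 0 then Some (a, b - 1, c + 1) else None))"

fun eps :: "int \<Rightarrow> ms \<Rightarrow> nat" where
  "eps i (a, b, c) = (if i = 1 then b + nat (max (int c - int a) 0) else a)"

fun eps_star :: "int \<Rightarrow> ms \<Rightarrow> nat" where
  "eps_star i (a, b, c) = (if i = 1 then c else b + nat (max (int a - int c) 0))"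

text \<open>\<open>wt m j\<close> is the coefficient of the simple root \<open>\<alpha>\<^sub>j\<close> in the weight of \<open>m\<close>.\<close>

fun wt :: "ms \<Rightarrow> int \<Rightarrow> int" where
  "wt (a, b, c) j = (if j = 1 then - int (b + c) else - int (a + b))"

definition phi_star :: "int \<Rightarrow> ms \<Rightarrow> int" where
  "phi_star i m = int (eps_star i m) + (\<Sum>j\<in>I0. cartan i j * wt m j)"

definition opt_pow :: "('a \<Rightarrow> 'a option) \<Rightarrow> nat \<Rightarrow> 'a \<Rightarrow> 'a option" where
  "opt_pow e n m = ((\<lambda>x. Option.bind x e) ^^ n) (Some m)"

text \<open>Only used when \<open>eps i m = 0\<close>; then \<open>phi_star i m \<ge> 0\<close>. The powers of \<open>e_star\<close> and \<open>e_op\<close> in the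
  next two definitions never reach \<open>None\<close>.\<close>

definition saito :: "int \<Rightarrow> ms \<Rightarrow> ms" where
  "saito i m = (f_op i ^^ nat (phi_star i m)) (the (opt_pow (e_star i) (eps_star i m) m))"

definition saito_ext :: "int \<Rightarrow> ms \<Rightarrow> ms" where
  "saito_ext i m = saito i (the (opt_pow (e_op i) (eps i m) m))"

definition MS_hat :: "(int \<Rightarrow> ms) set" where
  "MS_hat = {m. finite {k. m k \<noteq> (0, 0, 0)}}"

definition R_op :: "int \<Rightarrow> (int \<Rightarrow> ms) \<Rightarrow> (int \<Rightarrow> ms)" where
  "R_op i m = (\<lambda>k. (f_star i ^^ eps i (m (k - 1))) (saito_ext i (m k)))"

definition ms_monomial :: "(int \<Rightarrow> ms) \<Rightarrow> monomial" where
  "ms_monomial m = Y_product (\<lambda>k. fst (m k)) (\<lambda>k. fst (snd (m k))) (\<lambda>k. snd (snd (m k)))"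

definition phi_iso :: "'k::field \<Rightarrow> (int \<Rightarrow> ms) \<Rightarrow> 'k loop_mod set" where
  "phi_iso q m = V_class q (ms_monomial m)"

definition R_refl :: "'k::field \<Rightarrow> int \<Rightarrow> 'k loop_mod set \<Rightarrow> 'k loop_mod set" where
  "R_refl q i = restrict (phi_iso q \<circ> R_op i \<circ> inv_into MS_hat (phi_iso q)) (B_g q)"

end

theory Submission
  imports Defs
begin

text \<open>
  For a single triple the operators \<open>R\<^sub>1\<close> and \<open>R\<^sub>2\<close> of the extended crystal can be evaluated in closed form
  (\<open>R_op_1\<close>, \<open>R_op_2\<close>), and the result is exactly the pattern of exponents in \<open>M'\<close> and \<open>M''\<close>. The statement about
  modules follows once \<open>\<phi>\<close> can be inverted at \<open>[V(M)]\<close>, that is, once the following two facts are known.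

  A simple module is determined up to isomorphism by its Drinfeld polynomials (\<open>is_V_unique\<close>), so that
  \<open>[V(M)]\<close> is a single isomorphism class. Conversely, the isomorphism class determines the Drinfeld
  polynomials, these determine \<open>M\<close>, and \<open>M\<close> determines the exponents (\<open>drinfeld_monomial_unique\<close>,
  \<open>ms_monomial_inj\<close>).

  Both facts rest on the submodule generated by a highest weight vector \<open>v\<close>. The relations
  of the loop algebra allow \<open>x\<^sup>+\<close> and \<open>\<psi>\<close> to be moved past \<open>x\<^sup>-\<close>, so this submodule is spanned by products of
  lowering operators applied to \<open>v\<close>. The operator \<open>K\<^sub>1 K\<^sub>2\<close> has eigenvalue \<open>\<lambda> q\<^sup>-\<^sup>m\<close> on products of \<open>m\<close> factors. Since
  \<open>q\<close> is not a root of unity these eigenvalues are different, and an eigenvector lies in one level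
  (\<open>eigenvector_in_level\<close>). It follows that a simple module has only one highest weight vector up
  to scalars (\<open>highest_weight_unique\<close>). Applied to the vector \<open>(v, w)\<close> in \<open>V \<oplus> W\<close>, the separation of levels shows that two simple
  modules with the same highest weight are isomorphic, because the submodule generated by \<open>(v, w)\<close> is the
  graph of an isomorphism (\<open>iso_of_common_highest_weight\<close>).

  The eigenvalues of \<open>\<psi>(z)\<close> on the highest weight vector and the Drinfeld polynomials determine each
  other by comparing coefficients (\<open>series_determines_poly\<close>, \<open>poly_determines_series_plus\<close>,
  \<open>poly_determines_series_minus\<close>).
\<close>

section \<open>The reflections on the extended crystal\<close>

lemma opt_pow_0 [simp]: "opt_pow e 0 m = Some m"
  by (simp add: opt_pow_def)

lemma opt_pow_Suc: "e m = Some m' \<Longrightarrow> opt_pow e (Suc n) m = opt_pow e n m'"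
  by (simp add: opt_pow_def funpow_Suc_right del: funpow.simps)

lemma e1_pow_le: "c \<le> a \<Longrightarrow> opt_pow (e_op 1) b (a, b, c) = Some (a + b, 0, c)"
proof (induction b arbitrary: a)
  case (Suc b)
  have "e_op 1 (a, Suc b, c) = Some (Suc a, b, c)" using Suc.prems by simp
  from opt_pow_Suc[of "e_op 1", OF this] show ?case using Suc.IH[of "Suc a"] Suc.prems by simp
qed simp

lemma e1_pow_diff: "opt_pow (e_op 1) (n + d) (a, b, a + d) = opt_pow (e_op 1) n (a, b, a)"
proof (induction d)
  case (Suc d)
  have "e_op 1 (a, b, a + Suc d) = Some (a, b, a + d)" by simp
  from opt_pow_Suc[of "e_op 1", OF this] show ?case using Suc.IH by simp
qed simp

text \<open>
  While there are more \<open>[1]\<close> than \<open>[2]\<close>, the operator removes a \<open>[1]\<close>; afterwards it turns each \<open>[1,2]\<close>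
  into a \<open>[2]\<close>.
\<close>

lemma e1_pow_eps: "opt_pow (e_op 1) (eps 1 (a, b, c)) (a, b, c) = Some (a + b, 0, min a c)"
proof (cases "a \<le> c")
  case True
  then obtain d where d: "c = a + d" using le_Suc_ex by blast
  have "nat (max (int c - int a) 0) = d" by (simp add: d)
  then show ?thesis using e1_pow_diff[of b d a b] e1_pow_le[of a a b] by (simp add: d)
next
  case False
  then have "nat (max (int c - int a) 0) = 0" by simp
  then show ?thesis using e1_pow_le[of c a b] False by simp
qed

lemma e1_star_pow: "opt_pow (e_star 1) c (a, b, c) = Some (a, b, 0)"
proof (induction c)
  case (Suc c)
  have "e_star 1 (a, b, Suc c) = Some (a, b, c)" by simp
  from opt_pow_Suc[of "e_star 1", OF this] show ?case using Suc.IH by simp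
qed simp

lemma f1_pow: "n \<le> a \<Longrightarrow> (f_op 1 ^^ n) (a, b, 0) = (a - n, b + n, 0)"
  by (induction n) auto

lemma f1_star_pow: "(f_star 1 ^^ n) (a, b, c) = (a, b, c + n)"
  by (induction n) auto

lemma e2_pow: "opt_pow (e_op 2) a (a, b, c) = Some (0, b, c)"
proof (induction a)
  case (Suc a)
  have "e_op 2 (Suc a, b, c) = Some (a, b, c)" by simp
  from opt_pow_Suc[of "e_op 2", OF this] show ?case using Suc.IH by simp
qed simp

lemma e2_star_pow: "opt_pow (e_star 2) b (0, b, c) = Some (0, 0, b + c)"
proof (induction b arbitrary: c)
  case (Suc b)
  have "e_star 2 (0, Suc b, c) = Some (0, b, Suc c)" by simp
  from opt_pow_Suc[of "e_star 2", OF this] show ?case using Suc.IH by simp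
qed simp

lemma f2_pow: "(f_op 2 ^^ n) (a, b, c) = (a + n, b, c)"
  by (induction n) auto

text \<open>
  The operator turns a \<open>[1]\<close> into a \<open>[1,2]\<close> as long as there are fewer \<open>[2]\<close> than \<open>[1]\<close>. Starting from
  \<open>c\<close> copies of \<open>[2]\<close> and \<open>b + c\<close> of \<open>[1]\<close> this happens \<open>b\<close> times; from then on it adds a \<open>[2]\<close>.
\<close>

lemma f2_star_pow:
  "(f_star 2 ^^ n) (c, 0, b + c) = (c + n - min n b, min n b, b + c - min n b)"
  by (induction n) (auto simp: min_def)

text \<open>
  First \<open>e\<^sub>1\<close> leads to \<open>(a + b)[2] + min a c [1]\<close>, then \<open>e\<^sub>1\<^sup>*\<close> removes all \<open>[1]\<close>, and finally
  \<open>\<phi>\<^sub>1\<^sup>* = a + b - min a c\<close> of the \<open>[2]\<close> become \<open>[1,2]\<close>.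
\<close>

lemma saito_ext_1: "saito_ext 1 (a, b, c) = (min a c, a + b - min a c, 0)"
proof -
  have phi: "nat (phi_star 1 (a + b, 0, min a c)) = a + b - min a c"
    by (simp add: phi_star_def I0_def cartan_def)
  have "saito 1 (a + b, 0, min a c) = (min a c, a + b - min a c, 0)"
    unfolding saito_def phi by (simp add: e1_star_pow f1_pow del: f_op.simps e_star.simps)
  then show ?thesis by (simp add: saito_ext_def e1_pow_eps del: eps.simps)
qed

text \<open>
  First \<open>e\<^sub>2\<close> removes all \<open>[2]\<close>, then \<open>e\<^sub>2\<^sup>*\<close> turns the \<open>[1,2]\<close> into \<open>[1]\<close>, and finally \<open>\<phi>\<^sub>2\<^sup>* = c\<close>
  copies of \<open>[2]\<close> are added.
\<close>

lemma saito_ext_2: "saito_ext 2 (a, b, c) = (c, 0, b + c)"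
proof -
  have phi: "nat (phi_star 2 (0, b, c)) = c"
    by (simp add: phi_star_def I0_def cartan_def)
  have "saito 2 (0, b, c) = (c, 0, b + c)"
    unfolding saito_def phi by (simp add: e2_star_pow f2_pow del: f_op.simps e_star.simps)
  then show ?thesis by (simp add: saito_ext_def e2_pow)
qed

lemma R_op_1:
  "R_op 1 (\<lambda>k. (a k, b k, c k)) = (\<lambda>k.
     (min (a k) (c k),
      b k + nat (max (int (a k) - int (c k)) 0),
      b (k - 1) + nat (max (int (c (k - 1)) - int (a (k - 1))) 0)))"
proof
  fix k
  have "a k + b k - min (a k) (c k) = b k + nat (max (int (a k) - int (c k)) 0)"
    by (cases "a k \<le> c k") auto
  then show "R_op 1 (\<lambda>k. (a k, b k, c k)) k =
     (min (a k) (c k),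
      b k + nat (max (int (a k) - int (c k)) 0),
      b (k - 1) + nat (max (int (c (k - 1)) - int (a (k - 1))) 0))"
    unfolding R_op_def saito_ext_1 f1_star_pow by simp
qed

lemma R_op_2:
  "R_op 2 (\<lambda>k. (a k, b k, c k)) = (\<lambda>k.
     (a (k - 1) + c k - min (a (k - 1)) (b k),
      min (a (k - 1)) (b k),
      b k + c k - min (a (k - 1)) (b k)))"
  unfolding R_op_def saito_ext_2 f2_star_pow by (simp add: add.commute)

section \<open>Dominant monomials\<close>

lemma inv_D: "inv_into UNIV D (i, a) = (3 - i, a - 3)"
  by (rule inv_f_eq) (auto simp: inj_def D_def)

lemma Dpow_eq: "Dpow k (i, a) = (if even k then i else 3 - i, a + 3 * k)"
proof -
  have pos: "(D ^^ n) (i, a) = (if even n then i else 3 - i, a + 3 * int n)" for n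
    by (induction n) (auto simp: D_def)
  have neg: "(inv_into UNIV D ^^ n) (i, a) = (if even n then i else 3 - i, a - 3 * int n)" for n
    by (induction n) (auto simp: inv_D)
  show ?thesis
    by (auto simp: Dpow_def pos neg even_nat_iff)
qed

lemma lookup_Y_product:
  assumes "finite A" "\<forall>k. k \<notin> A \<longrightarrow> a k = 0 \<and> b k = 0 \<and> c k = 0"
  shows "Poly_Mapping.lookup (Y_product a b c) p =
    (\<Sum>k\<in>A. if Dpow k (1, 2) = p then a k else 0) + (\<Sum>k\<in>A. if Dpow k (2, 1) = p then b k else 0)
      + (\<Sum>k\<in>A. if Dpow k (1, 0) = p then c k else 0)"
proof -
  have "Y_product a b c = (\<Sum>k\<in>A.
    Ypow (Dpow k (1, 2)) (a k) + Ypow (Dpow k (2, 1)) (b k) + Ypow (Dpow k (1, 0)) (c k))"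
    unfolding Y_product_def
  proof (rule Sum_any.expand_superset[OF assms(1)], clarify, rule ccontr)
    fix k assume "k \<notin> A"
      "Ypow (Dpow k (1, 2)) (a k) + Ypow (Dpow k (2, 1)) (b k) + Ypow (Dpow k (1, 0)) (c k) \<noteq> 0"
    then show False using assms(2) by (simp add: Ypow_def)
  qed
  then show ?thesis
    by (simp add: lookup_sum lookup_add Ypow_def lookup_single when_def sum.distrib)
qed

lemma Dpow_eq_iff:
  "Dpow k (1, 2) = Dpow l (1, 2) \<longleftrightarrow> k = l"
  "Dpow k (2, 1) = Dpow l (2, 1) \<longleftrightarrow> k = l"
  "Dpow k (1, 0) = Dpow l (1, 0) \<longleftrightarrow> k = l"
  by (auto simp: Dpow_eq)

text \<open>
  The spectral parameters in the three orbits differ modulo \<open>3\<close>.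
\<close>

lemma Dpow_neq:
  "Dpow k (1, 2) \<noteq> Dpow l (2, 1)" "Dpow k (1, 2) \<noteq> Dpow l (1, 0)"
  "Dpow k (2, 1) \<noteq> Dpow l (1, 2)" "Dpow k (2, 1) \<noteq> Dpow l (1, 0)"
  "Dpow k (1, 0) \<noteq> Dpow l (1, 2)" "Dpow k (1, 0) \<noteq> Dpow l (2, 1)"
proof -
  have "2 + 3 * k \<noteq> 1 + 3 * l" "2 + 3 * k \<noteq> 3 * l" "1 + 3 * k \<noteq> 3 * l"
    "1 + 3 * k \<noteq> 2 + 3 * l" "3 * k \<noteq> 2 + 3 * l" "3 * k \<noteq> 1 + 3 * l"
    by presburger+
  then show
    "Dpow k (1, 2) \<noteq> Dpow l (2, 1)" "Dpow k (1, 2) \<noteq> Dpow l (1, 0)"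
    "Dpow k (2, 1) \<noteq> Dpow l (1, 2)" "Dpow k (2, 1) \<noteq> Dpow l (1, 0)"
    "Dpow k (1, 0) \<noteq> Dpow l (1, 2)" "Dpow k (1, 0) \<noteq> Dpow l (2, 1)"
    by (simp_all add: Dpow_eq)
qed

lemma lookup_Y_product_Dpow:
  assumes fin: "finite {k. a k \<noteq> 0 \<or> b k \<noteq> 0 \<or> c k \<noteq> 0}"
  shows "Poly_Mapping.lookup (Y_product a b c) (Dpow k (1, 2)) = a k"
    and "Poly_Mapping.lookup (Y_product a b c) (Dpow k (2, 1)) = b k"
    and "Poly_Mapping.lookup (Y_product a b c) (Dpow k (1, 0)) = c k"
proof -
  \<comment> \<open>The index \<open>k\<close> itself is added because all three exponents may vanish there.\<close>
  let ?A = "insert k {k. a k \<noteq> 0 \<or> b k \<noteq> 0 \<or> c k \<noteq> 0}"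
  have A: "finite ?A" "\<forall>l. l \<notin> ?A \<longrightarrow> a l = 0 \<and> b l = 0 \<and> c l = 0"
    using fin by auto
  have delta: "(\<Sum>l\<in>?A. if l = k then x l else 0) = x k" for x :: "int \<Rightarrow> nat"
    by (subst sum.delta[OF A(1)]) simp
  show "Poly_Mapping.lookup (Y_product a b c) (Dpow k (1, 2)) = a k"
    "Poly_Mapping.lookup (Y_product a b c) (Dpow k (2, 1)) = b k"
    "Poly_Mapping.lookup (Y_product a b c) (Dpow k (1, 0)) = c k"
    by (simp_all only: lookup_Y_product[of ?A a b c, OF A] Dpow_eq_iff delta Dpow_neq if_False
        sum.neutral_const add_0 add_0_right)
qed

lemma keys_Y_product:
  assumes fin: "finite {k. a k \<noteq> 0 \<or> b k \<noteq> 0 \<or> c k \<noteq> 0}"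
  shows "Poly_Mapping.keys (Y_product a b c) \<subseteq> S_Z"
proof
  have "(2 + 3 * k - (if even k then 1 else 3 - 1)) mod 2 = 1"
    "(1 + 3 * k - (if even k then 2 else 3 - 2)) mod 2 = 1"
    "(0 + 3 * k - (if even k then 1 else 3 - 1)) mod 2 = 1" for k :: int
    by presburger+
  then have S: "Dpow k (1, 2) \<in> S_Z" "Dpow k (2, 1) \<in> S_Z" "Dpow k (1, 0) \<in> S_Z" for k
    unfolding Dpow_eq S_Z_def I0_def by simp_all
  fix p assume "p \<in> Poly_Mapping.keys (Y_product a b c)"
  show "p \<in> S_Z"
  proof (rule ccontr)
    assume "p \<notin> S_Z"
    then have "Dpow k (1, 2) \<noteq> p" "Dpow k (2, 1) \<noteq> p" "Dpow k (1, 0) \<noteq> p" for k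
      using S by auto
    then have "Poly_Mapping.lookup (Y_product a b c) p = 0"
      by (subst lookup_Y_product[OF fin]) auto
    then show False using \<open>p \<in> Poly_Mapping.keys _\<close> by (simp add: in_keys_iff)
  qed
qed

lemma ms_monomial_inj:
  assumes "m \<in> MS_hat" "m' \<in> MS_hat" "ms_monomial m = ms_monomial m'"
  shows "m = m'"
proof
  fix k
  have fin: "finite {k. fst (l k) \<noteq> 0 \<or> fst (snd (l k)) \<noteq> 0 \<or> snd (snd (l k)) \<noteq> 0}"
    if "l \<in> MS_hat" for l
    by (rule finite_subset[of _ "{k. l k \<noteq> (0, 0, 0)}"]) (use that in \<open>auto simp: MS_hat_def\<close>)
  note lookup = lookup_Y_product_Dpow[OF fin, folded ms_monomial_def]
  show "m k = m' k"
    using lookup[OF assms(1), of k] lookup[OF assms(2), of k] assms(3)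
    by (simp add: prod_eq_iff)
qed

section \<open>Drinfeld polynomials\<close>

lemma powi_inj:
  fixes q :: "'k::field"
  assumes "q \<noteq> 0" "\<And>n. n > 0 \<Longrightarrow> q ^ n \<noteq> 1"
  shows "q powi m = q powi n \<longleftrightarrow> m = n"
proof
  have le: "n = m" if "q powi m = q powi n" "m \<le> n" for m n :: int
  proof (rule ccontr)
    assume "n \<noteq> m"
    have "q ^ nat (n - m) = 1"
      using that assms(1) power_int_diff[of q n m] by (simp flip: power_int_of_nat)
    then show False using assms(2)[of "nat (n - m)"] that \<open>n \<noteq> m\<close> by simp
  qed
  assume eq: "q powi m = q powi n"
  show "m = n"
    using le[OF eq] le[OF eq[symmetric]] by (cases "m \<le> n") simp_all
qed simp

lemma order_prod_roots:
  fixes q :: "'k::field"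
  assumes q: "q \<noteq> 0" "\<And>n. n > 0 \<Longrightarrow> q ^ n \<noteq> 1" and "finite A"
  shows "order (inverse (q powi s)) (\<Prod>p\<in>A. [:1, - (q powi p):] ^ u p) = (if s \<in> A then u s else 0)"
  using \<open>finite A\<close>
proof induction
  case (insert t A)
  have nz: "[:1, - (q powi p):] \<noteq> 0" for p by simp
  have prod_nz: "(\<Prod>p\<in>A. [:1, - (q powi p):] ^ u p) \<noteq> 0" using insert.hyps by simp
  have pow: "order (inverse (q powi s)) ([:1, - (q powi t):] ^ u t) = (if s = t then u t else 0)"
  proof (cases "s = t")
    case True
    have "[:1, - (q powi t):] = Polynomial.smult (- (q powi t)) [:- inverse (q powi t), 1:]"
      using q(1) by simp
    then have "[:1, - (q powi t):] ^ u t
        = Polynomial.smult ((- (q powi t)) ^ u t) ([:- inverse (q powi t), 1:] ^ u t)"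
      by (simp only: smult_power)
    then show ?thesis using True q(1) by (simp add: order_smult order_power_n_n)
  next
    case False
    then have "q powi s \<noteq> q powi t" by (simp add: powi_inj[OF q])
    then have "poly ([:1, - (q powi t):] ^ u t) (inverse (q powi s)) \<noteq> 0"
      using q(1) by (simp add: field_simps)
    then show ?thesis using False by (simp add: order_0I)
  qed
  have "order (inverse (q powi s)) (\<Prod>p\<in>insert t A. [:1, - (q powi p):] ^ u p)
      = order (inverse (q powi s)) ([:1, - (q powi t):] ^ u t)
        + order (inverse (q powi s)) (\<Prod>p\<in>A. [:1, - (q powi p):] ^ u p)"
    unfolding prod.insert[OF insert.hyps] using prod_nz nz by (intro order_mult) simp
  also have "\<dots> = (if s = t then u t else 0) + (if s \<in> A then u s else 0)"
    by (simp only: pow insert.IH)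
  also have "\<dots> = (if s \<in> insert t A then u s else 0)"
    using insert.hyps(2) by auto
  finally show ?case .
qed (simp add: order_0I[of 1])

text \<open>
  As \<open>q\<close> is not a root of unity, the numbers \<open>q\<^sup>-\<^sup>s\<close> are pairwise different, so the exponent of \<open>Y\<^sub>i\<^sub>,\<^sub>s\<close> is the
  multiplicity of the root \<open>q\<^sup>-\<^sup>s\<close> of the \<open>i\<close>-th polynomial.
\<close>

lemma drinfeld_poly_inj:
  fixes q :: "'k::field"
  assumes q: "q \<noteq> 0" "\<And>n. n > 0 \<Longrightarrow> q ^ n \<noteq> 1"
    and keys: "Poly_Mapping.keys M \<subseteq> S_Z" "Poly_Mapping.keys M' \<subseteq> S_Z"
    and eq: "\<And>i. i \<in> I0 \<Longrightarrow> drinfeld_poly q M i = drinfeld_poly q M' i"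
  shows "M = M'"
proof (rule poly_mapping_eqI)
  have lookup: "Poly_Mapping.lookup N (i, s) = order (inverse (q powi s)) (drinfeld_poly q N i)"
    for N i s
  proof -
    have "finite {p. Poly_Mapping.lookup N (i, p) \<noteq> 0}"
      using finite_vimageI[of "Poly_Mapping.keys N" "Pair i"]
      by (simp add: vimage_def in_keys_iff inj_def)
    then show ?thesis
      unfolding drinfeld_poly_def by (subst order_prod_roots[OF q]) auto
  qed
  fix p :: "int \<times> int"
  obtain i s where p: "p = (i, s)" by (cases p)
  show "Poly_Mapping.lookup M p = Poly_Mapping.lookup M' p"
  proof (cases "i \<in> I0")
    case True
    then show ?thesis by (simp add: p lookup eq)
  next
    case False
    then have "p \<notin> Poly_Mapping.keys M" "p \<notin> Poly_Mapping.keys M'"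
      using keys by (auto simp: p S_Z_def)
    then show ?thesis by (simp add: in_keys_iff)
  qed
qed

lemma coeff_0_drinfeld_poly: "coeff (drinfeld_poly q M i) 0 = 1"
proof -
  have "poly (drinfeld_poly q M i) 0 = 1"
    unfolding drinfeld_poly_def by (simp only: poly_prod poly_power) simp
  then show ?thesis by (simp only: poly_0_coeff_0)
qed

text \<open>
  The series \<open>\<Sum> \<kappa>\<^sub>r z\<^sup>r\<close> is an expansion of \<open>q\<^bsup>deg P\<^esup> P(q\<^sup>-\<^sup>1 z) / P(q z)\<close>, written without denominators. For \<open>P(0) = 1\<close> it is the
  expansion at \<open>0\<close> if \<open>\<kappa>\<close> vanishes at negative indices, and at \<open>\<infinity>\<close> if it vanishes at positive ones.
\<close>

definition series_of_poly :: "'k::field \<Rightarrow> 'k poly \<Rightarrow> (int \<Rightarrow> 'k) \<Rightarrow> bool" where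
  "series_of_poly q P \<kappa> \<longleftrightarrow> (\<forall>m. (\<Sum>n\<le>degree P. coeff P n * q ^ n * \<kappa> (m - int n))
     = q ^ degree P * (if 0 \<le> m then coeff P (nat m) * q powi (- m) else 0))"

lemma series_of_poly_extend:
  assumes "series_of_poly q P \<kappa>" "\<And>r. r < 0 \<Longrightarrow> \<kappa> r = 0"
  shows "(\<Sum>n\<le>m. coeff P n * q ^ n * \<kappa> (int (m - n))) = q ^ degree P * coeff P m * q powi (- int m)"
proof -
  have "(\<Sum>n\<le>m. coeff P n * q ^ n * \<kappa> (int (m - n)))
      = (\<Sum>n\<le>m. coeff P n * q ^ n * \<kappa> (int m - int n))"
    by (rule sum.cong) (auto simp: of_nat_diff)
  also have "\<dots> = (\<Sum>n\<le>max m (degree P). coeff P n * q ^ n * \<kappa> (int m - int n))"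
    by (rule sum.mono_neutral_left) (auto simp: assms(2))
  also have "\<dots> = (\<Sum>n\<le>degree P. coeff P n * q ^ n * \<kappa> (int m - int n))"
    by (rule sum.mono_neutral_right) (auto simp: coeff_eq_0)
  finally show ?thesis using assms(1) unfolding series_of_poly_def by (simp add: mult.assoc)
qed

text \<open>
  The coefficient of \<open>z\<^sup>m\<close> expresses \<open>p\<^sub>m \<kappa>\<^sub>0 (q\<^sup>-\<^sup>m - q\<^sup>m)\<close> in terms of \<open>p\<^sub>n\<close> with \<open>n < m\<close>. Since \<open>q\<close> is not a root of
  unity, the factor of \<open>p\<^sub>m\<close> is nonzero for \<open>m > 0\<close>, and this is a recursion for the coefficients of \<open>P\<close>.
\<close>

lemma series_determines_poly:
  fixes q :: "'k::field"
  assumes q: "q \<noteq> 0" "\<And>n. n > 0 \<Longrightarrow> q ^ n \<noteq> 1"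
    and P: "series_of_poly q P \<kappa>" "coeff P 0 = 1"
    and P': "series_of_poly q P' \<kappa>" "coeff P' 0 = 1"
    and \<kappa>: "\<And>r. r < 0 \<Longrightarrow> \<kappa> r = 0"
  shows "P = P'"
proof (rule poly_eqI)
  fix m
  have d: "q ^ degree P = \<kappa> 0" "q ^ degree P' = \<kappa> 0"
    using series_of_poly_extend[OF P(1) \<kappa>, of 0] series_of_poly_extend[OF P'(1) \<kappa>, of 0] P(2) P'(2)
    by auto
  have \<kappa>0: "\<kappa> 0 \<noteq> 0" unfolding d(1)[symmetric] using q(1) by simp
  have rec: "coeff Q m * (\<kappa> 0 * (q powi (- int m) - q ^ m))
      = (\<Sum>n<m. coeff Q n * q ^ n * \<kappa> (int (m - n)))"
    if "series_of_poly q Q \<kappa>" "q ^ degree Q = \<kappa> 0" for Q m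
    using series_of_poly_extend[OF that(1) \<kappa>, of m] that(2)
    unfolding lessThan_Suc_atMost[symmetric] sum.lessThan_Suc by (simp add: algebra_simps)
  show "coeff P m = coeff P' m"
  proof (induction m rule: less_induct)
    case (less m)
    show ?case
    proof (cases "m = 0")
      case False
      have "q powi (- int m) \<noteq> q powi (int m)" using False powi_inj[OF q, of "- int m" "int m"] by simp
      then have "\<kappa> 0 * (q powi (- int m) - q ^ m) \<noteq> 0" using \<kappa>0 by simp
      moreover have "coeff P m * (\<kappa> 0 * (q powi (- int m) - q ^ m))
          = coeff P' m * (\<kappa> 0 * (q powi (- int m) - q ^ m))"
        unfolding rec[OF P(1) d(1)] rec[OF P'(1) d(2)] using less by (auto intro: sum.cong)
      ultimately show ?thesis by simp
    qed (simp add: P P')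
  qed
qed

text \<open>
  The constant coefficient of \<open>P\<close> is \<open>1\<close>, so the coefficient of \<open>z\<^sup>m\<close> gives \<open>\<kappa>\<^sub>m\<close> in terms of \<open>\<kappa>\<^sub>r\<close> with \<open>r < m\<close>.
\<close>

lemma poly_determines_series_plus:
  fixes q :: "'k::field"
  assumes P: "coeff P 0 = 1" "series_of_poly q P \<kappa>" "series_of_poly q P \<kappa>'"
    and \<kappa>: "\<And>r. r < 0 \<Longrightarrow> \<kappa> r = 0" "\<And>r. r < 0 \<Longrightarrow> \<kappa>' r = 0"
  shows "\<kappa> = \<kappa>'"
proof
  have nn: "\<kappa> (int m) = \<kappa>' (int m)" for m
  proof (induction m rule: less_induct)
    case (less m)
    have rec: "\<mu> (int m) + (\<Sum>n\<in>{1..m}. coeff P n * q ^ n * \<mu> (int (m - n)))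
        = q ^ degree P * coeff P m * q powi (- int m)"
      if "series_of_poly q P \<mu>" "\<And>r. r < 0 \<Longrightarrow> \<mu> r = 0" for \<mu>
      using series_of_poly_extend[OF that, of m] P(1)
      by (simp add: atMost_atLeast0 sum.atLeast_Suc_atMost)
    have "(\<Sum>n\<in>{1..m}. coeff P n * q ^ n * \<kappa> (int (m - n)))
        = (\<Sum>n\<in>{1..m}. coeff P n * q ^ n * \<kappa>' (int (m - n)))"
    proof (rule sum.cong)
      fix n assume "n \<in> {1..m}"
      then have "\<kappa> (int (m - n)) = \<kappa>' (int (m - n))" by (intro less) simp
      then show "coeff P n * q ^ n * \<kappa> (int (m - n)) = coeff P n * q ^ n * \<kappa>' (int (m - n))"
        by (simp only:)
    qed simp
    then show ?case
      using trans[OF rec[OF P(2) \<kappa>(1)] rec[OF P(3) \<kappa>(2), symmetric]]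
      by (simp only: add_right_cancel)
  qed
  fix r show "\<kappa> r = \<kappa>' r"
    using nn[of "nat r"] \<kappa>[of r] by (cases "r < 0") auto
qed

text \<open>
  With \<open>d = deg P\<close>, the leading coefficient is nonzero, so the coefficient of \<open>z\<^bsup>d - m\<^esup>\<close> gives \<open>\<kappa>\<^sub>-\<^sub>m\<close> in terms of
  \<open>\<kappa>\<^sub>r\<close> with \<open>r > - m\<close>.
\<close>

lemma poly_determines_series_minus:
  fixes q :: "'k::field"
  assumes "q \<noteq> 0"
    and P: "P \<noteq> 0" "series_of_poly q P \<kappa>" "series_of_poly q P \<kappa>'"
    and \<kappa>: "\<And>r. r > 0 \<Longrightarrow> \<kappa> r = 0" "\<And>r. r > 0 \<Longrightarrow> \<kappa>' r = 0"
  shows "\<kappa> = \<kappa>'"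
proof
  let ?d = "degree P"
  have nn: "\<kappa> (- int m) = \<kappa>' (- int m)" for m
  proof (induction m rule: less_induct)
    case (less m)
    have above: "\<kappa> r = \<kappa>' r" if "r > - int m" for r
      using less[of "nat (- r)"] \<kappa>[of r] that by (cases "r > 0") auto
    have split: "(\<Sum>n\<le>?d. coeff P n * q ^ n * \<mu> (int ?d - int m - int n))
        = (\<Sum>n<?d. coeff P n * q ^ n * \<mu> (int ?d - int m - int n))
          + lead_coeff P * q ^ ?d * \<mu> (- int m)" for \<mu> :: "int \<Rightarrow> 'k"
      unfolding lessThan_Suc_atMost[symmetric] sum.lessThan_Suc by simp
    have "(\<Sum>n<?d. coeff P n * q ^ n * \<kappa> (int ?d - int m - int n))
        = (\<Sum>n<?d. coeff P n * q ^ n * \<kappa>' (int ?d - int m - int n))"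
      by (auto intro!: sum.cong above)
    moreover have "(\<Sum>n\<le>?d. coeff P n * q ^ n * \<kappa> (int ?d - int m - int n))
        = (\<Sum>n\<le>?d. coeff P n * q ^ n * \<kappa>' (int ?d - int m - int n))"
      using P(2,3) unfolding series_of_poly_def by simp
    ultimately have "lead_coeff P * q ^ ?d * \<kappa> (- int m) = lead_coeff P * q ^ ?d * \<kappa>' (- int m)"
      unfolding split by simp
    then show ?case using P(1) \<open>q \<noteq> 0\<close> by simp
  qed
  fix r show "\<kappa> r = \<kappa>' r"
    using nn[of "nat (- r)"] \<kappa>[of r] by (cases "r > 0") auto
qed

section \<open>Subspaces and matrices over a field\<close>

definition lin_closed :: "nat \<Rightarrow> 'k::field vec set \<Rightarrow> bool" where
  "lin_closed n S \<longleftrightarrow> S \<subseteq> carrier_vec n \<and> 0\<^sub>v n \<in> S \<and> (\<forall>u\<in>S. \<forall>w\<in>S. u + w \<in> S)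
     \<and> (\<forall>c. \<forall>u\<in>S. c \<cdot>\<^sub>v u \<in> S)"

lemma lin_closedD:
  assumes "lin_closed n S"
  shows "u \<in> S \<Longrightarrow> u \<in> carrier_vec n" "0\<^sub>v n \<in> S" "u \<in> S \<Longrightarrow> w \<in> S \<Longrightarrow> u + w \<in> S"
    "u \<in> S \<Longrightarrow> c \<cdot>\<^sub>v u \<in> S"
  using assms by (auto simp: lin_closed_def)

lemma lin_closed_diff:
  assumes S: "lin_closed n S" and "u \<in> S" "w \<in> S"
  shows "u - w \<in> S"
proof -
  have "u - w = u + (-1) \<cdot>\<^sub>v w"
    using lin_closedD(1)[OF S \<open>u \<in> S\<close>] lin_closedD(1)[OF S \<open>w \<in> S\<close>] by auto
  then show ?thesis using lin_closedD[OF S] assms by auto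
qed

lemma subspace_iff_lin_closed:
  "subspace class_ring (S :: 'k::field vec set) (module_vec TYPE('k) n) \<longleftrightarrow> lin_closed n S"
proof -
  interpret vec_space "TYPE('k)" n .
  show ?thesis
    unfolding subspace_def submodule_def lin_closed_def
    using vectorspace_axioms module_axioms by (auto simp: module_vec_simps)
qed

lemma smult_mat_mult_vec:
  assumes "A \<in> carrier_mat n m" "u \<in> carrier_vec m"
  shows "(c \<cdot>\<^sub>m A) *\<^sub>v u = c \<cdot>\<^sub>v (A *\<^sub>v (u :: 'k::field vec))"
  using assms by (intro eq_vecI) auto

lemma zero_mat_vec: "u \<in> carrier_vec m \<Longrightarrow> 0\<^sub>m n m *\<^sub>v u = (0\<^sub>v n :: 'k::field vec)"
  by (intro eq_vecI) auto

lemma mat_zero_vec: "A \<in> carrier_mat n m \<Longrightarrow> A *\<^sub>v 0\<^sub>v m = (0\<^sub>v n :: 'k::field vec)"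
  by (intro eq_vecI) auto

lemma smult_zero_vecs:
  "u \<in> carrier_vec n \<Longrightarrow> 0 \<cdot>\<^sub>v u = (0\<^sub>v n :: 'k::field vec)" "c \<cdot>\<^sub>v 0\<^sub>v n = (0\<^sub>v n :: 'k vec)"
  by (intro eq_vecI; auto)+

lemma mat_vec_eqI:
  assumes "A \<in> carrier_mat n m" "B \<in> carrier_mat n m"
    and eq: "\<And>v. v \<in> carrier_vec m \<Longrightarrow> A *\<^sub>v v = (B :: 'k::field mat) *\<^sub>v v"
  shows "A = B"
proof (rule mat_col_eqI)
  fix j assume "j < dim_col B"
  then have j: "j < m" using assms by simp
  have "col M j = M *\<^sub>v unit_vec m j" if "M \<in> carrier_mat n m" for M :: "'k mat"
    using that j by (intro eq_vecI) (auto simp: scalar_prod_right_unit)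
  then show "col A j = col B j" using eq[of "unit_vec m j"] assms by simp
qed (use assms in auto)

lemma mult_mat_vec_mem:
  assumes S: "lin_closed n S" and A: "A \<in> carrier_mat n k" and cols: "\<And>j. j < k \<Longrightarrow> col A j \<in> S"
    and u: "u \<in> carrier_vec k"
  shows "A *\<^sub>v u \<in> S"
proof -
  have "l \<le> k \<Longrightarrow> vec n (\<lambda>i. \<Sum>j<l. A $$ (i, j) * u $ j) \<in> S" for l
  proof (induction l)
    case 0
    have "vec n (\<lambda>i. \<Sum>j<0. A $$ (i, j) * u $ j) = 0\<^sub>v n" by (intro eq_vecI) auto
    then show ?case using lin_closedD(2)[OF S] by simp
  next
    case (Suc l)
    have "vec n (\<lambda>i. \<Sum>j<Suc l. A $$ (i, j) * u $ j)
        = vec n (\<lambda>i. \<Sum>j<l. A $$ (i, j) * u $ j) + (u $ l) \<cdot>\<^sub>v col A l"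
      using A Suc.prems by (intro eq_vecI) auto
    then show ?case using Suc cols[of l] lin_closedD(3,4)[OF S] by simp
  qed
  moreover have "A *\<^sub>v u = vec n (\<lambda>i. \<Sum>j<k. A $$ (i, j) * u $ j)"
    using A u by (intro eq_vecI) (auto simp: scalar_prod_def lessThan_atLeast0)
  ultimately show ?thesis by simp
qed

lemma append_rows_mult_vec:
  assumes "A \<in> carrier_mat n k" "B \<in> carrier_mat m k" "u \<in> carrier_vec k"
  shows "mat (n + m) k (\<lambda>(i, j). if i < n then A $$ (i, j) else B $$ (i - n, j)) *\<^sub>v u
    = (A *\<^sub>v u) @\<^sub>v (B *\<^sub>v (u :: 'k::field vec))"
  using assms by (intro eq_vecI) (auto simp: scalar_prod_def)

text \<open>
  The traces of \<open>P Q\<close> and \<open>Q P\<close> agree; in characteristic zero this is an equality of natural numbers.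
\<close>

lemma inverse_mats_square:
  fixes P Q :: "'k::field_char_0 mat"
  assumes P: "P \<in> carrier_mat m n" and Q: "Q \<in> carrier_mat n m"
    and PQ: "P * Q = 1\<^sub>m m" and QP: "Q * P = 1\<^sub>m n"
  shows "n = m"
proof -
  have trace: "(\<Sum>i<k. (A * B) $$ (i, i)) = (\<Sum>i<k. \<Sum>j<l. A $$ (i, j) * B $$ (j, i))"
    if "A \<in> carrier_mat k l" "B \<in> carrier_mat l k" for A B :: "'k mat" and k l
    using that by (intro sum.cong) (auto simp: scalar_prod_def lessThan_atLeast0)
  have "of_nat m = (\<Sum>i<m. (1\<^sub>m m :: 'k mat) $$ (i, i))" by simp
  also have "\<dots> = (\<Sum>i<m. \<Sum>j<n. P $$ (i, j) * Q $$ (j, i))"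
    unfolding PQ[symmetric] by (rule trace[OF P Q])
  also have "\<dots> = (\<Sum>j<n. \<Sum>i<m. Q $$ (j, i) * P $$ (i, j))"
    by (subst sum.swap) (simp add: mult.commute)
  also have "\<dots> = (\<Sum>i<n. (1\<^sub>m n :: 'k mat) $$ (i, i))"
    unfolding QP[symmetric] by (rule trace[OF Q P, symmetric])
  also have "\<dots> = of_nat n" by simp
  finally show ?thesis by simp
qed

text \<open>
  A subspace of \<open>k\<^sup>n \<oplus> k\<^sup>m\<close> that projects onto both summands and meets each of them only in \<open>0\<close> is the graph of
  an invertible matrix. The columns of this matrix are partners of the unit vectors, and the partners
  for the other projection give its inverse.
\<close>

lemma graph_of_isomorphism:
  fixes S :: "'k::field_char_0 vec set"
  assumes S: "lin_closed (n + m) S"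
    and left: "\<forall>a\<in>carrier_vec n. \<exists>b\<in>carrier_vec m. a @\<^sub>v b \<in> S"
    and right: "\<forall>b\<in>carrier_vec m. \<exists>a\<in>carrier_vec n. a @\<^sub>v b \<in> S"
    and left_kernel: "\<forall>b\<in>carrier_vec m. 0\<^sub>v n @\<^sub>v b \<in> S \<longrightarrow> b = 0\<^sub>v m"
    and right_kernel: "\<forall>a\<in>carrier_vec n. a @\<^sub>v 0\<^sub>v m \<in> S \<longrightarrow> a = 0\<^sub>v n"
  shows "\<exists>P. n = m \<and> P \<in> carrier_mat n n \<and> invertible_mat P
    \<and> (\<forall>a\<in>carrier_vec n. a @\<^sub>v (P *\<^sub>v a) \<in> S)
    \<and> (\<forall>a\<in>carrier_vec n. \<forall>b\<in>carrier_vec m. a @\<^sub>v b \<in> S \<longrightarrow> b = P *\<^sub>v a)"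
proof -
  have diff: "(a - a') @\<^sub>v (b - b') = (a @\<^sub>v b) - (a' @\<^sub>v b')"
    if "a \<in> carrier_vec n" "a' \<in> carrier_vec n" "b \<in> carrier_vec m" "b' \<in> carrier_vec m"
    for a a' b b' :: "'k vec"
    using that by (intro eq_vecI) auto
  have eq0: "c = c'" if "c - c' = 0\<^sub>v k" "c \<in> carrier_vec k" "c' \<in> carrier_vec k"
    for c c' :: "'k vec" and k
  proof (rule eq_vecI)
    fix i assume "i < dim_vec c'"
    then show "c $ i = c' $ i" using arg_cong[OF that(1), of "\<lambda>w. w $ i"] that(2,3) by auto
  qed (use that in auto)
  have unique_right: "b = b'" if "a @\<^sub>v b \<in> S" "a @\<^sub>v b' \<in> S"
    "a \<in> carrier_vec n" "b \<in> carrier_vec m" "b' \<in> carrier_vec m" for a b b'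
  proof -
    have "(a - a) @\<^sub>v (b - b') \<in> S"
      unfolding diff[OF that(3,3,4,5)] by (rule lin_closed_diff[OF S that(1,2)])
    then have "b - b' = 0\<^sub>v m" using that by (intro left_kernel[rule_format]) simp_all
    then show ?thesis by (rule eq0[OF _ that(4,5)])
  qed
  have unique_left: "a = a'" if "a @\<^sub>v b \<in> S" "a' @\<^sub>v b \<in> S"
    "a \<in> carrier_vec n" "a' \<in> carrier_vec n" "b \<in> carrier_vec m" for a a' b
  proof -
    have "(a - a') @\<^sub>v (b - b) \<in> S"
      unfolding diff[OF that(3,4,5,5)] by (rule lin_closed_diff[OF S that(1,2)])
    then have "a - a' = 0\<^sub>v n" using that by (intro right_kernel[rule_format]) simp_all
    then show ?thesis by (rule eq0[OF _ that(3,4)])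
  qed
  obtain f where f: "\<And>a. a \<in> carrier_vec n \<Longrightarrow> f a \<in> carrier_vec m \<and> a @\<^sub>v f a \<in> S"
    using bchoice[of "carrier_vec n" "\<lambda>a b. b \<in> carrier_vec m \<and> a @\<^sub>v b \<in> S"] left by blast
  obtain g where g: "\<And>b. b \<in> carrier_vec m \<Longrightarrow> g b \<in> carrier_vec n \<and> g b @\<^sub>v b \<in> S"
    using bchoice[of "carrier_vec m" "\<lambda>b a. a \<in> carrier_vec n \<and> a @\<^sub>v b \<in> S"] right by blast
  define P where "P = mat m n (\<lambda>(i, j). f (unit_vec n j) $ i)"
  define Q where "Q = mat n m (\<lambda>(i, j). g (unit_vec m j) $ i)"
  have P: "P \<in> carrier_mat m n" and Q: "Q \<in> carrier_mat n m" by (simp_all add: P_def Q_def)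
  have PS: "a @\<^sub>v (P *\<^sub>v a) \<in> S" if a: "a \<in> carrier_vec n" for a
  proof -
    \<comment> \<open>The columns of the stacked matrix \<open>(1, P)\<close> lie in \<open>S\<close>, hence so do all its values.\<close>
    let ?A = "mat (n + m) n (\<lambda>(i, j). if i < n then 1\<^sub>m n $$ (i, j) else P $$ (i - n, j))"
    have "?A *\<^sub>v a \<in> S"
    proof (rule mult_mat_vec_mem[OF S _ _ a])
      fix j assume j: "j < n"
      have "col ?A j = unit_vec n j @\<^sub>v f (unit_vec n j)"
        using j f[of "unit_vec n j"] by (intro eq_vecI) (auto simp: P_def)
      then show "col ?A j \<in> S" using f[of "unit_vec n j"] by simp
    qed simp
    then show ?thesis using append_rows_mult_vec[OF one_carrier_mat P a] a by simp
  qed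
  have QS: "(Q *\<^sub>v b) @\<^sub>v b \<in> S" if b: "b \<in> carrier_vec m" for b
  proof -
    let ?A = "mat (n + m) m (\<lambda>(i, j). if i < n then Q $$ (i, j) else 1\<^sub>m m $$ (i - n, j))"
    have "?A *\<^sub>v b \<in> S"
    proof (rule mult_mat_vec_mem[OF S _ _ b])
      fix j assume j: "j < m"
      have "col ?A j = g (unit_vec m j) @\<^sub>v unit_vec m j"
        using j g[of "unit_vec m j"] by (intro eq_vecI) (auto simp: Q_def)
      then show "col ?A j \<in> S" using g[of "unit_vec m j"] by simp
    qed simp
    then show ?thesis using append_rows_mult_vec[OF Q one_carrier_mat b] b by simp
  qed
  have vec: "P *\<^sub>v a \<in> carrier_vec m" "Q *\<^sub>v b \<in> carrier_vec n" for a b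
    using P Q by (intro carrier_vecI; simp)+
  have PQ: "P * Q = 1\<^sub>m m"
  proof (rule mat_vec_eqI)
    fix b :: "'k vec" assume b: "b \<in> carrier_vec m"
    have "P *\<^sub>v (Q *\<^sub>v b) = b"
      using unique_right[OF PS[OF vec(2)] QS[OF b]] vec b by simp
    then show "(P * Q) *\<^sub>v b = 1\<^sub>m m *\<^sub>v b" using P Q b by simp
  qed (use P Q in auto)
  have QP: "Q * P = 1\<^sub>m n"
  proof (rule mat_vec_eqI)
    fix a :: "'k vec" assume a: "a \<in> carrier_vec n"
    have "Q *\<^sub>v (P *\<^sub>v a) = a"
      using unique_left[OF QS[OF vec(1)] PS[OF a]] vec a by simp
    then show "(Q * P) *\<^sub>v a = 1\<^sub>m n *\<^sub>v a" using P Q a by simp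
  qed (use P Q in auto)
  have nm: "n = m" by (rule inverse_mats_square[OF P Q PQ QP])
  have "invertible_mat P"
    unfolding invertible_mat_def inverts_mat_def using P Q PQ QP nm by auto
  moreover have "P \<in> carrier_mat n n" using P nm by simp
  ultimately show ?thesis
    using nm by (intro exI[of _ P] conjI ballI impI PS) (auto intro!: unique_right[OF _ PS _ _ vec(1)])
qed

lemma invertible_mat_iff:
  assumes P: "P \<in> carrier_mat n n"
  shows "invertible_mat P \<longleftrightarrow> (\<exists>Q\<in>carrier_mat n n. P * Q = 1\<^sub>m n \<and> Q * P = 1\<^sub>m n)"
proof
  assume "invertible_mat P"
  then obtain Q where PQ: "P * Q = 1\<^sub>m n" and QP: "Q * P = 1\<^sub>m (dim_row Q)"
    using P unfolding invertible_mat_def inverts_mat_def by auto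
  have "Q \<in> carrier_mat n n"
    using arg_cong[OF PQ, of dim_col] arg_cong[OF QP, of dim_col] P by auto
  with PQ QP show "\<exists>Q\<in>carrier_mat n n. P * Q = 1\<^sub>m n \<and> Q * P = 1\<^sub>m n" by auto
next
  assume "\<exists>Q\<in>carrier_mat n n. P * Q = 1\<^sub>m n \<and> Q * P = 1\<^sub>m n"
  then show "invertible_mat P"
    using P unfolding invertible_mat_def inverts_mat_def by auto
qed

section \<open>Modules over the loop algebra\<close>

lemma loop_moduleD:
  assumes "loop_module q V"
  shows xop_carrier: "e \<in> signs \<Longrightarrow> i \<in> I0 \<Longrightarrow> xop V e i r \<in> carrier_mat (mdim V) (mdim V)"
    and psi_carrier: "e \<in> signs \<Longrightarrow> i \<in> I0 \<Longrightarrow> psi V e i r \<in> carrier_mat (mdim V) (mdim V)"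
    and psi_vanishes: "e \<in> signs \<Longrightarrow> i \<in> I0 \<Longrightarrow> e * r < 0 \<Longrightarrow> psi V e i r = 0\<^sub>m (mdim V) (mdim V)"
    and psi_inverse: "i \<in> I0 \<Longrightarrow> psi V 1 i 0 * psi V (- 1) i 0 = 1\<^sub>m (mdim V)"
    and psi_commute: "e \<in> signs \<Longrightarrow> e' \<in> signs \<Longrightarrow> i \<in> I0 \<Longrightarrow> j \<in> I0 \<Longrightarrow>
      psi V e i r * psi V e' j s = psi V e' j s * psi V e i r"
    and psi_xop: "e' \<in> signs \<Longrightarrow> e \<in> signs \<Longrightarrow> i \<in> I0 \<Longrightarrow> j \<in> I0 \<Longrightarrow>
      psi V e' i (r + 1) * xop V e j s
        - (q powi (e * cartan i j)) \<cdot>\<^sub>m (psi V e' i r * xop V e j (s + 1))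
      = (q powi (e * cartan i j)) \<cdot>\<^sub>m (xop V e j s * psi V e' i (r + 1))
        - xop V e j (s + 1) * psi V e' i r"
    and xop_xop: "e \<in> signs \<Longrightarrow> i \<in> I0 \<Longrightarrow> j \<in> I0 \<Longrightarrow>
      xop V e i (r + 1) * xop V e j s
        - (q powi (e * cartan i j)) \<cdot>\<^sub>m (xop V e j s * xop V e i (r + 1))
      = (q powi (e * cartan i j)) \<cdot>\<^sub>m (xop V e i r * xop V e j (s + 1))
        - xop V e j (s + 1) * xop V e i r"
    and xop_plus_minus: "i \<in> I0 \<Longrightarrow> j \<in> I0 \<Longrightarrow>
      xop V 1 i r * xop V (- 1) j s - xop V (- 1) j s * xop V 1 i r
      = (if i = j then inverse (q - inverse q) \<cdot>\<^sub>m (psi V 1 i (r + s) - psi V (- 1) i (r + s))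
         else 0\<^sub>m (mdim V) (mdim V))"
    and serre: "e \<in> signs \<Longrightarrow> i \<in> I0 \<Longrightarrow> j \<in> I0 \<Longrightarrow> i \<noteq> j \<Longrightarrow>
      serre_term q (xop V e i r) (xop V e i r') (xop V e j s)
      + serre_term q (xop V e i r') (xop V e i r) (xop V e j s) = 0\<^sub>m (mdim V) (mdim V)"
proof -
  note d = assms[unfolded loop_module_def Let_def]
  note d1 = conjunct1[OF d] and r1 = conjunct2[OF d]
  note d2 = conjunct1[OF r1] and r2 = conjunct2[OF r1]
  note d3 = conjunct1[OF r2] and r3 = conjunct2[OF r2]
  note d4 = conjunct1[OF r3] and r4 = conjunct2[OF r3]
  note d5 = conjunct1[OF r4] and r5 = conjunct2[OF r4]
  note d6 = conjunct1[OF r5] and r6 = conjunct2[OF r5]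
  note d7 = conjunct1[OF r6] and d8 = conjunct2[OF r6]
  show "e \<in> signs \<Longrightarrow> i \<in> I0 \<Longrightarrow> xop V e i r \<in> carrier_mat (mdim V) (mdim V)"
    "e \<in> signs \<Longrightarrow> i \<in> I0 \<Longrightarrow> psi V e i r \<in> carrier_mat (mdim V) (mdim V)"
    using d1 by simp_all
  show "e \<in> signs \<Longrightarrow> i \<in> I0 \<Longrightarrow> e * r < 0 \<Longrightarrow> psi V e i r = 0\<^sub>m (mdim V) (mdim V)"
    using d2 by simp
  show "i \<in> I0 \<Longrightarrow> psi V 1 i 0 * psi V (- 1) i 0 = 1\<^sub>m (mdim V)"
    using d3 by simp
  show "e \<in> signs \<Longrightarrow> e' \<in> signs \<Longrightarrow> i \<in> I0 \<Longrightarrow> j \<in> I0 \<Longrightarrow>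
      psi V e i r * psi V e' j s = psi V e' j s * psi V e i r"
    by (rule d4[rule_format])
  show "e' \<in> signs \<Longrightarrow> e \<in> signs \<Longrightarrow> i \<in> I0 \<Longrightarrow> j \<in> I0 \<Longrightarrow>
      psi V e' i (r + 1) * xop V e j s
        - (q powi (e * cartan i j)) \<cdot>\<^sub>m (psi V e' i r * xop V e j (s + 1))
      = (q powi (e * cartan i j)) \<cdot>\<^sub>m (xop V e j s * psi V e' i (r + 1))
        - xop V e j (s + 1) * psi V e' i r"
    by (rule d5[rule_format])
  show "e \<in> signs \<Longrightarrow> i \<in> I0 \<Longrightarrow> j \<in> I0 \<Longrightarrow>
      xop V e i (r + 1) * xop V e j s
        - (q powi (e * cartan i j)) \<cdot>\<^sub>m (xop V e j s * xop V e i (r + 1))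
      = (q powi (e * cartan i j)) \<cdot>\<^sub>m (xop V e i r * xop V e j (s + 1))
        - xop V e j (s + 1) * xop V e i r"
    by (rule d6[rule_format])
  show "i \<in> I0 \<Longrightarrow> j \<in> I0 \<Longrightarrow>
      xop V 1 i r * xop V (- 1) j s - xop V (- 1) j s * xop V 1 i r
      = (if i = j then inverse (q - inverse q) \<cdot>\<^sub>m (psi V 1 i (r + s) - psi V (- 1) i (r + s))
         else 0\<^sub>m (mdim V) (mdim V))"
    by (rule d7[rule_format])
  show "e \<in> signs \<Longrightarrow> i \<in> I0 \<Longrightarrow> j \<in> I0 \<Longrightarrow> i \<noteq> j \<Longrightarrow>
      serre_term q (xop V e i r) (xop V e i r') (xop V e j s)
      + serre_term q (xop V e i r') (xop V e i r) (xop V e j s) = 0\<^sub>m (mdim V) (mdim V)"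
    by (rule d8[rule_format])
qed

locale loop_rep =
  fixes q :: "'k::field" and V :: "'k loop_mod"
  assumes loop: "loop_module q V"
    and q_nonzero: "q \<noteq> 0"
    and q_generic: "\<And>n. n > 0 \<Longrightarrow> q ^ n \<noteq> 1"
begin

abbreviation "N \<equiv> mdim V"
abbreviation "x \<equiv> xop V"
abbreviation "\<psi> \<equiv> psi V"

lemmas op_carrier [simp] = loop_moduleD(1,2)[OF loop]

lemma vec_carrier [simp]:
  assumes "e \<in> signs" "i \<in> I0" "u \<in> carrier_vec N"
  shows "x e i r *\<^sub>v u \<in> carrier_vec N" "\<psi> e i r *\<^sub>v u \<in> carrier_vec N"
  using mult_mat_vec_carrier[OF op_carrier(1)[OF assms(1,2)] assms(3)]
    mult_mat_vec_carrier[OF op_carrier(2)[OF assms(1,2)] assms(3)] by simp_all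

lemma psi_x_rel_vec:
  assumes "e' \<in> signs" "e \<in> signs" "i \<in> I0" "j \<in> I0" "u \<in> carrier_vec N"
  defines "c \<equiv> q powi (e * cartan i j)"
  shows "\<psi> e' i (r + 1) *\<^sub>v (x e j s *\<^sub>v u) - c \<cdot>\<^sub>v (\<psi> e' i r *\<^sub>v (x e j (s + 1) *\<^sub>v u))
    = c \<cdot>\<^sub>v (x e j s *\<^sub>v (\<psi> e' i (r + 1) *\<^sub>v u)) - x e j (s + 1) *\<^sub>v (\<psi> e' i r *\<^sub>v u)"
proof -
  note [simp] = assms(1-5)
  have [simp]: "A * B \<in> carrier_mat N N" if "A \<in> carrier_mat N N" "B \<in> carrier_mat N N"
    for A B :: "'k mat" using that by simp
  have assoc: "(A * B) *\<^sub>v u = A *\<^sub>v (B *\<^sub>v u)" "(c \<cdot>\<^sub>m (A * B)) *\<^sub>v u = c \<cdot>\<^sub>v (A *\<^sub>v (B *\<^sub>v u))"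
    if "A \<in> carrier_mat N N" "B \<in> carrier_mat N N" for A B :: "'k mat"
    using that assms(5) assoc_mult_mat_vec[OF that assms(5)]
    by (auto simp: smult_mat_mult_vec[of _ N N])
  show ?thesis
    using arg_cong[OF psi_xop[OF loop assms(1-4), of r s, folded c_def], of "\<lambda>A. A *\<^sub>v u"]
    by (simp add: minus_mult_distrib_mat_vec[of _ N N] assoc)
qed

lemma x_x_rel_vec:
  assumes "i \<in> I0" "j \<in> I0" "u \<in> carrier_vec N"
  shows "x 1 i r *\<^sub>v (x (- 1) j s *\<^sub>v u) = x (- 1) j s *\<^sub>v (x 1 i r *\<^sub>v u)
    + (if i = j then inverse (q - inverse q) else 0)
      \<cdot>\<^sub>v (\<psi> 1 i (r + s) *\<^sub>v u - \<psi> (- 1) i (r + s) *\<^sub>v u)"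
proof -
  have s: "1 \<in> signs" "- 1 \<in> signs" by (auto simp: signs_def)
  note [simp] = assms s
  have "(x 1 i r * x (- 1) j s - x (- 1) j s * x 1 i r) *\<^sub>v u
      = x 1 i r *\<^sub>v (x (- 1) j s *\<^sub>v u) - x (- 1) j s *\<^sub>v (x 1 i r *\<^sub>v u)"
    by (simp add: minus_mult_distrib_mat_vec[of _ N N] mult_carrier_mat[of _ N N _ N]
        assoc_mult_mat_vec[of _ N N _ N])
  moreover have "(x 1 i r * x (- 1) j s - x (- 1) j s * x 1 i r) *\<^sub>v u
      = (if i = j then inverse (q - inverse q) else 0)
      \<cdot>\<^sub>v (\<psi> 1 i (r + s) *\<^sub>v u - \<psi> (- 1) i (r + s) *\<^sub>v u)"
    unfolding xop_plus_minus[OF loop assms(1,2)]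
    by (auto simp: minus_mult_distrib_mat_vec[of _ N N] smult_mat_mult_vec[of _ N N]
        zero_mat_vec smult_zero_vecs(1)[of _ N] minus_carrier_vec minus_carrier_mat)
  ultimately have eq: "x 1 i r *\<^sub>v (x (- 1) j s *\<^sub>v u) - x (- 1) j s *\<^sub>v (x 1 i r *\<^sub>v u)
      = (if i = j then inverse (q - inverse q) else 0)
      \<cdot>\<^sub>v (\<psi> 1 i (r + s) *\<^sub>v u - \<psi> (- 1) i (r + s) *\<^sub>v u)" by simp
  have "A = B + (A - B)" if "A \<in> carrier_vec N" "B \<in> carrier_vec N" for A B :: "'k vec"
    using that by (intro eq_vecI) auto
  from this[of "x 1 i r *\<^sub>v (x (- 1) j s *\<^sub>v u)" "x (- 1) j s *\<^sub>v (x 1 i r *\<^sub>v u)"]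
  show ?thesis unfolding eq by simp
qed

lemma psi0_x_vec:
  assumes "e \<in> signs" "i \<in> I0" "j \<in> I0" "u \<in> carrier_vec N"
  shows "\<psi> 1 i 0 *\<^sub>v (x e j s *\<^sub>v u) = q powi (e * cartan i j) \<cdot>\<^sub>v (x e j s *\<^sub>v (\<psi> 1 i 0 *\<^sub>v u))"
proof -
  have s: "1 \<in> signs" by (auto simp: signs_def)
  \<comment> \<open>At \<open>r = - 1\<close> the mode \<open>\<psi>\<^sub>r\<close> is zero, which leaves one term on each side of the relation.\<close>
  have z: "\<psi> 1 i (- 1) = 0\<^sub>m N N" using psi_vanishes[OF loop s assms(2), of "-1"] by simp
  have 1: "x e j (s + 1) *\<^sub>v 0\<^sub>v N = 0\<^sub>v N"
    using op_carrier(1)[OF assms(1,3), of "s + 1"] by (intro eq_vecI) auto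
  have 2: "w - 0\<^sub>v N = w" if "w \<in> carrier_vec N" for w :: "'k vec"
    using that by (intro eq_vecI) auto
  show ?thesis
    using psi_x_rel_vec[OF s assms, of "- 1" s] assms s
    by (simp add: z 1 2 zero_mat_vec smult_zero_vecs smult_carrier_vec)
qed

text \<open>
  The exchange relation of \<open>\<psi>\<^sub>i(z)\<close> and \<open>x\<^sub>j(w)\<close> is a recursion in the mode \<open>r\<close> of \<open>\<psi>\<close>. It starts on the side where
  the modes of \<open>\<psi>\<close> vanish, and rewrites \<open>\<psi>\<^sub>r x\<^sub>s\<close> as a combination of products \<open>x\<^sub>t \<psi>\<^sub>p\<close>. This replaces the
  part of the triangular decomposition that concerns the Cartan currents.
\<close>

lemma psi_x_mem:
  assumes "e' \<in> signs" "e \<in> signs" "i \<in> I0" "j \<in> I0" and u: "u \<in> carrier_vec N"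
    and S: "lin_closed N S" and mem: "\<And>r s. x e j s *\<^sub>v (\<psi> e' i r *\<^sub>v u) \<in> S"
  shows "\<psi> e' i r *\<^sub>v (x e j s *\<^sub>v u) \<in> S"
proof -
  define c where "c = q powi (e * cartan i j)"
  have c: "c \<noteq> 0" using q_nonzero by (simp add: c_def)
  note [simp] = assms(1-5)
  define A where "A r s = \<psi> e' i r *\<^sub>v (x e j s *\<^sub>v u)" for r s
  define B where "B r s = x e j s *\<^sub>v (\<psi> e' i r *\<^sub>v u)" for r s
  have car: "A r s \<in> carrier_vec N" "B r s \<in> carrier_vec N" for r s
    by (simp_all add: A_def B_def)
  then have dim: "dim_vec (A r s) = N" "dim_vec (B r s) = N" for r s by auto
  have B: "B r s \<in> S" for r s using mem by (simp add: B_def)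
  have rel: "A (r + 1) s - c \<cdot>\<^sub>v A r (s + 1) = c \<cdot>\<^sub>v B (r + 1) s - B r (s + 1)" for r s
    using psi_x_rel_vec[OF assms(1-5), of r s] unfolding A_def B_def c_def .
  have rel': "A (r + 1) s $ k - c * A r (s + 1) $ k = c * B (r + 1) s $ k - B r (s + 1) $ k"
    if "k < N" for r s k
    using arg_cong[OF rel[of r s], of "\<lambda>w. w $ k"] that by (simp add: dim)
  have up: "A (r + 1) s = c \<cdot>\<^sub>v A r (s + 1) + (c \<cdot>\<^sub>v B (r + 1) s - B r (s + 1))" for r s
    using rel'[of _ r s] by (intro eq_vecI) (auto simp: dim algebra_simps)
  have down: "A r (s + 1) = inverse c \<cdot>\<^sub>v (A (r + 1) s - (c \<cdot>\<^sub>v B (r + 1) s - B r (s + 1)))" for r s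
    using rel'[of _ r s] c by (intro eq_vecI) (auto simp: dim field_simps)
  note S_closed = lin_closedD(3,4)[OF S] lin_closed_diff[OF S] B
  have zero: "A r s \<in> S" if "e' * r < 0" for r s
    unfolding A_def psi_vanishes[OF loop assms(1,3) that] using lin_closedD(2)[OF S]
    by (simp add: zero_mat_vec)
  have "\<forall>s. A r s \<in> S"
  proof (cases "e' = 1")
    case True
    show ?thesis
    proof (cases "r < 0")
      case False
      then have "- 1 \<le> r" by simp
      then show ?thesis
      proof (induction r rule: int_ge_induct)
        case (step r)
        then show ?case unfolding up by (auto intro!: S_closed)
      qed (use zero True in auto)
    qed (use zero True in auto)
  next
    case False
    then have e': "e' = - 1" using assms(1) by (auto simp: signs_def)
    show ?thesis
    proof (cases "r > 0")
      case False
      then have "r \<le> 1" by simp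
      then show ?thesis
      proof (induction r rule: int_le_induct)
        case (step r)
        have "A (r - 1) s = A (r - 1) ((s - 1) + 1)" for s by simp
        then have "A (r - 1) s = inverse c \<cdot>\<^sub>v (A r (s - 1) - (c \<cdot>\<^sub>v B r (s - 1) - B (r - 1) s))" for s
          using down[of "r - 1" "s - 1"] by simp
        then show ?case using step by (auto intro!: S_closed)
      qed (use zero e' in auto)
    qed (use zero e' in auto)
  qed
  then show ?thesis by (simp add: A_def)
qed

end

section \<open>Highest weight vectors\<close>

locale hw_rep = loop_rep q V for q :: "'k::field" and V +
  fixes v :: "'k vec" and \<kappa> :: "int \<Rightarrow> int \<Rightarrow> int \<Rightarrow> 'k"
  assumes v: "v \<in> carrier_vec N" and v_nonzero: "v \<noteq> 0\<^sub>v N"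
    and hw: "\<And>i r. i \<in> I0 \<Longrightarrow> x 1 i r *\<^sub>v v = 0\<^sub>v N"
    and psi_v: "\<And>e i r. e \<in> signs \<Longrightarrow> i \<in> I0 \<Longrightarrow> \<psi> e i r *\<^sub>v v = \<kappa> e i r \<cdot>\<^sub>v v"
begin

text \<open>
  Level \<open>m\<close> is the span of the products of \<open>m\<close> lowering operators applied to \<open>v\<close>. Generating it inductively
  makes its invariance properties accessible to rule induction, without a basis of such products.
\<close>

inductive level :: "nat \<Rightarrow> 'k vec \<Rightarrow> bool" where
  hw_vector: "level 0 v"
| lower: "level m u \<Longrightarrow> i \<in> I0 \<Longrightarrow> level (Suc m) (x (- 1) i r *\<^sub>v u)"
| add: "level m u \<Longrightarrow> level m w \<Longrightarrow> level m (u + w)"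
| smult: "level m u \<Longrightarrow> level m (c \<cdot>\<^sub>v u)"

lemma signs_mem [simp]: "1 \<in> signs" "- 1 \<in> signs"
  by (auto simp: signs_def)

lemma I0_mem [simp]: "1 \<in> I0" "2 \<in> I0"
  by (auto simp: I0_def)

lemma level_carrier: "level m u \<Longrightarrow> u \<in> carrier_vec N"
  by (induction rule: level.induct) (auto simp: v)

lemma mult_zero [simp]: 
  "e \<in> signs \<Longrightarrow> i \<in> I0 \<Longrightarrow> x e i r *\<^sub>v 0\<^sub>v N = 0\<^sub>v N" "e \<in> signs \<Longrightarrow> i \<in> I0 \<Longrightarrow> \<psi> e i r *\<^sub>v 0\<^sub>v N = 0\<^sub>v N"
  using mat_zero_vec[OF op_carrier(1)] mat_zero_vec[OF op_carrier(2)] by auto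

lemma level_zero: "level m (0\<^sub>v N)"
proof (induction m)
  case 0
  have "0 \<cdot>\<^sub>v v = 0\<^sub>v N" using v by auto
  then show ?case using level.smult[OF hw_vector, of 0] by simp
next
  case (Suc m)
  then show ?case using level.lower[OF Suc, of 1 0] by simp
qed

lemma lin_closed_level: "lin_closed N {u. level m u}"
  unfolding lin_closed_def using level_carrier level_zero by (auto intro: level.add level.smult)

lemma level_0D: "level m u \<Longrightarrow> m = 0 \<Longrightarrow> \<exists>c. u = c \<cdot>\<^sub>v v"
proof (induction rule: level.induct)
  case hw_vector
  show ?case by (rule exI[of _ 1]) simp
next
  case (add m u w)
  then obtain c d where "u = c \<cdot>\<^sub>v v" "w = d \<cdot>\<^sub>v v" by auto
  then show ?case by (intro exI[of _ "c + d"]) (simp add: add_smult_distrib_vec)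
next
  case (smult m u c)
  then obtain d where "u = d \<cdot>\<^sub>v v" by auto
  then show ?case by (intro exI[of _ "c * d"]) (simp add: smult_smult_assoc)
qed simp

lemma psi_level:
  "level m u \<Longrightarrow> e \<in> signs \<Longrightarrow> i \<in> I0 \<Longrightarrow> level m (\<psi> e i r *\<^sub>v u)"
proof (induction arbitrary: r rule: level.induct)
  case hw_vector
  then show ?case by (auto simp: psi_v intro: level.intros)
next
  case (lower m u j s)
  have "\<psi> e i r *\<^sub>v (x (- 1) j s *\<^sub>v u) \<in> {w. level (Suc m) w}"
    using lower level_carrier
    by (intro psi_x_mem lin_closed_level) (auto intro: level.lower)
  then show ?case by simp
next
  case (add m u w)
  then show ?case
    by (simp add: mult_add_distrib_mat_vec[of _ N N] level_carrier level.add)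
next
  case (smult m u c)
  then show ?case
    by (simp add: mult_mat_vec[of _ N N] level_carrier level.smult)
qed

text \<open>
  Moving \<open>x\<^sup>+\<close> to the right of the outermost \<open>x\<^sup>-\<close> produces only modes of \<open>\<psi>\<close>, which preserve the level of the
  remaining product.
\<close>

lemma raise_level:
  "level m u \<Longrightarrow> i \<in> I0 \<Longrightarrow>
    (m = 0 \<longrightarrow> x 1 i r *\<^sub>v u = 0\<^sub>v N) \<and> (m \<noteq> 0 \<longrightarrow> level (m - 1) (x 1 i r *\<^sub>v u))"
proof (induction arbitrary: r rule: level.induct)
  case hw_vector
  then show ?case by (simp add: hw)
next
  case (lower m u j s)
  have "level m (x (- 1) j s *\<^sub>v (x 1 i r *\<^sub>v u))"
  proof (cases m)
    case 0
    then show ?thesis using lower level_zero by simp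
  next
    case (Suc k)
    then show ?thesis using lower level.lower[of k "x 1 i r *\<^sub>v u" j s] by simp
  qed
  moreover have "level m (\<psi> 1 i (r + s) *\<^sub>v u - \<psi> (- 1) i (r + s) *\<^sub>v u)"
    using lin_closed_diff[OF lin_closed_level] psi_level[OF lower(1)] lower by simp
  ultimately show ?case
    unfolding x_x_rel_vec[OF lower.prems lower.hyps(2) level_carrier[OF lower.hyps(1)]]
    by (auto intro!: level.add level.smult)
next
  case (add m u w)
  then show ?case
    by (auto simp: mult_add_distrib_mat_vec[of _ N N] level_carrier level.add)
next
  case (smult m u c)
  then show ?case
    by (auto simp: mult_mat_vec[of _ N N] level_carrier level.smult)
qed

text \<open>
  The operator \<open>K\<^sub>1 K\<^sub>2\<close> counts lowering operators: the entries of each column of the Cartan matrix add up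
  to \<open>1\<close>, so both \<open>x\<^sub>1\<^sup>-\<close> and \<open>x\<^sub>2\<^sup>-\<close> multiply its eigenvalue by \<open>q\<^sup>-\<^sup>1\<close>.
\<close>

definition K :: "'k vec \<Rightarrow> 'k vec" where
  "K u = \<psi> 1 1 0 *\<^sub>v (\<psi> 1 2 0 *\<^sub>v u)"

definition top_weight :: 'k where
  "top_weight = \<kappa> 1 1 0 * \<kappa> 1 2 0"

lemma K_carrier [simp]: "u \<in> carrier_vec N \<Longrightarrow> K u \<in> carrier_vec N"
  by (simp add: K_def)

lemma K_add: "u \<in> carrier_vec N \<Longrightarrow> w \<in> carrier_vec N \<Longrightarrow> K (u + w) = K u + K w"
  by (simp add: K_def mult_add_distrib_mat_vec[of _ N N])

lemma K_smult: "u \<in> carrier_vec N \<Longrightarrow> K (c \<cdot>\<^sub>v u) = c \<cdot>\<^sub>v K u"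
  by (simp add: K_def mult_mat_vec[of _ N N])

lemma K_lower:
  assumes "i \<in> I0" "u \<in> carrier_vec N"
  shows "K (x (- 1) i r *\<^sub>v u) = inverse q \<cdot>\<^sub>v (x (- 1) i r *\<^sub>v K u)"
proof -
  have "K (x (- 1) i r *\<^sub>v u)
      = (q powi (- cartan 2 i) * q powi (- cartan 1 i)) \<cdot>\<^sub>v (x (- 1) i r *\<^sub>v K u)"
    using assms by (simp add: K_def psi0_x_vec mult_mat_vec[of _ N N] smult_smult_assoc)
  moreover have "q powi (- cartan 2 i) * q powi (- cartan 1 i) = inverse q"
    using assms(1) q_nonzero
    by (auto simp: I0_def cartan_def power_int_minus power2_eq_square)
  ultimately show ?thesis by simp
qed

lemma K_level: "level m u \<Longrightarrow> K u = (top_weight * inverse q ^ m) \<cdot>\<^sub>v u"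
proof (induction rule: level.induct)
  case hw_vector
  then show ?case
    by (simp add: K_def psi_v mult_mat_vec[of _ N N] v smult_smult_assoc top_weight_def mult.commute)
next
  case (lower m u i r)
  then show ?case
    by (simp add: K_lower level_carrier mult_mat_vec[of _ N N] smult_smult_assoc mult_ac)
next
  case (add m u w)
  then show ?case by (simp add: K_add level_carrier smult_add_distrib_vec[of _ N])
next
  case (smult m u c)
  then show ?case by (simp add: K_smult level_carrier smult_smult_assoc mult.commute)
qed

lemma top_weight_nonzero: "top_weight \<noteq> 0"
proof -
  have "\<kappa> 1 i 0 \<noteq> 0" if i: "i \<in> I0" for i
  proof
    assume 0: "\<kappa> 1 i 0 = 0"
    have "v = (\<psi> 1 i 0 * \<psi> (- 1) i 0) *\<^sub>v v" unfolding psi_inverse[OF loop i] using v by simp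
    also have "\<dots> = \<psi> 1 i 0 *\<^sub>v (\<psi> (- 1) i 0 *\<^sub>v v)"
      using i v by (simp add: assoc_mult_mat_vec[of _ N N _ N])
    also have "\<dots> = 0\<^sub>v N"
      using i v by (simp add: psi_v mult_mat_vec[of _ N N] 0 smult_zero_vecs(1)[OF v] smult_zero_vecs(2))
    finally show False using v_nonzero by simp
  qed
  then show ?thesis by (simp add: top_weight_def)
qed

fun filt :: "nat \<Rightarrow> 'k vec set" where
  "filt 0 = {u. level 0 u}"
| "filt (Suc m) = {u + w | u w. u \<in> filt m \<and> level (Suc m) w}"

lemma lin_closed_filt: "lin_closed N (filt m)"
proof (induction m)
  case 0
  show ?case using lin_closed_level[of 0] by simp
next
  case (Suc m)
  note S = lin_closedD[OF Suc] and L = lin_closedD[OF lin_closed_level[of "Suc m"], simplified]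
  show ?case
    unfolding lin_closed_def
  proof (intro conjI ballI allI subsetI)
    show "0\<^sub>v N \<in> filt (Suc m)"
      using S(2) L(2) by (auto intro!: exI[of _ "0\<^sub>v N"])
  next
    fix u w assume "u \<in> filt (Suc m)" "w \<in> filt (Suc m)"
    then obtain u1 u2 w1 w2 where d: "u = u1 + u2" "w = w1 + w2" "u1 \<in> filt m" "w1 \<in> filt m"
      "level (Suc m) u2" "level (Suc m) w2" by auto
    have "u + w = (u1 + w1) + (u2 + w2)"
      unfolding d using S(1)[OF d(3)] S(1)[OF d(4)] L(1)[OF d(5)] L(1)[OF d(6)]
      by (intro eq_vecI) auto
    then show "u + w \<in> filt (Suc m)"
      using S(3)[OF d(3,4)] L(3)[OF d(5,6)] unfolding filt.simps mem_Collect_eq by blast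
  next
    fix c u assume "u \<in> filt (Suc m)"
    then obtain u1 u2 where d: "u = u1 + u2" "u1 \<in> filt m" "level (Suc m) u2" by auto
    have "c \<cdot>\<^sub>v u = c \<cdot>\<^sub>v u1 + c \<cdot>\<^sub>v u2"
      unfolding d using S(1)[OF d(2)] L(1)[OF d(3)] by (simp add: smult_add_distrib_vec[of _ N])
    then show "c \<cdot>\<^sub>v u \<in> filt (Suc m)"
      using S(4)[OF d(2)] L(4)[OF d(3)] unfolding filt.simps mem_Collect_eq by blast
  qed (use S(1) L(1) in auto)
qed

lemma filt_carrier: "u \<in> filt m \<Longrightarrow> u \<in> carrier_vec N"
  using lin_closedD(1)[OF lin_closed_filt] .

lemma filt_Suc: "filt m \<subseteq> filt (Suc m)"
proof
  fix u assume u: "u \<in> filt m"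
  then have "u = u + 0\<^sub>v N" using filt_carrier by simp
  then show "u \<in> filt (Suc m)" using u level_zero by auto
qed

lemma filt_mono: "m \<le> k \<Longrightarrow> filt m \<subseteq> filt k"
  using lift_Suc_mono_le[of filt, OF filt_Suc] .

lemma level_filt: "level m u \<Longrightarrow> u \<in> filt m"
proof (cases m)
  case (Suc k)
  assume u: "level m u"
  then have "u = 0\<^sub>v N + u" using level_carrier by simp
  then show ?thesis using u lin_closedD(2)[OF lin_closed_filt, of k] Suc by auto
qed simp

lemma psi_filt: "u \<in> filt m \<Longrightarrow> e \<in> signs \<Longrightarrow> i \<in> I0 \<Longrightarrow> \<psi> e i r *\<^sub>v u \<in> filt m"
proof (induction m arbitrary: u)
  case (Suc m)
  then obtain u1 u2 where d: "u = u1 + u2" "u1 \<in> filt m" "level (Suc m) u2" by auto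
  then show ?case
    using Suc by (auto simp: mult_add_distrib_mat_vec[of _ N N] level_carrier filt_carrier
        intro!: psi_level)
qed (simp add: psi_level)

lemma lower_filt: "u \<in> filt m \<Longrightarrow> i \<in> I0 \<Longrightarrow> x (- 1) i r *\<^sub>v u \<in> filt (Suc m)"
proof (induction m arbitrary: u)
  case 0
  then show ?case using level_filt[OF level.lower[of 0 u i r]] by simp
next
  case (Suc m)
  then obtain u1 u2 where d: "u = u1 + u2" "u1 \<in> filt m" "level (Suc m) u2" by auto
  have "x (- 1) i r *\<^sub>v u = x (- 1) i r *\<^sub>v u1 + x (- 1) i r *\<^sub>v u2"
    using d Suc by (simp add: mult_add_distrib_mat_vec[of _ N N] level_carrier filt_carrier)
  then show ?case
    unfolding filt.simps(2)[of "Suc m"] using Suc d level.lower[OF d(3)] by blast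
qed

lemma raise_filt: "u \<in> filt m \<Longrightarrow> i \<in> I0 \<Longrightarrow> x 1 i r *\<^sub>v u \<in> filt m"
proof (induction m arbitrary: u)
  case 0
  then show ?case using raise_level level_zero by simp
next
  case (Suc m)
  then obtain u1 u2 where d: "u = u1 + u2" "u1 \<in> filt m" "level (Suc m) u2" by auto
  have "x 1 i r *\<^sub>v u2 \<in> filt m" using raise_level[OF d(3) Suc.prems(2), of r] level_filt by simp
  then have "x 1 i r *\<^sub>v u1 + x 1 i r *\<^sub>v u2 \<in> filt m"
    using Suc d by (intro lin_closedD(3)[OF lin_closed_filt]) auto
  then have "x 1 i r *\<^sub>v u \<in> filt m"
    using d Suc by (simp add: mult_add_distrib_mat_vec[of _ N N] level_carrier filt_carrier)
  then show ?case using filt_Suc by blast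
qed

definition cyclic :: "'k vec set" where
  "cyclic = (\<Union>m. filt m)"

lemma lin_closed_cyclic: "lin_closed N cyclic"
  unfolding lin_closed_def cyclic_def
proof (intro conjI ballI allI)
  show "(\<Union>m. filt m) \<subseteq> carrier_vec N" using filt_carrier by auto
  show "0\<^sub>v N \<in> (\<Union>m. filt m)" using lin_closedD(2)[OF lin_closed_filt] by (rule UN_I[OF UNIV_I])
next
  fix u w assume "u \<in> (\<Union>m. filt m)" "w \<in> (\<Union>m. filt m)"
  then obtain m k where "u \<in> filt m" "w \<in> filt k" by auto
  then have "u \<in> filt (max m k)" "w \<in> filt (max m k)"
    using filt_mono[of m "max m k"] filt_mono[of k "max m k"] by auto
  from lin_closedD(3)[OF lin_closed_filt this] show "u + w \<in> (\<Union>m. filt m)" by auto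
next
  fix c u assume "u \<in> (\<Union>m. filt m)"
  then obtain m where "u \<in> filt m" by auto
  from lin_closedD(4)[OF lin_closed_filt this] show "c \<cdot>\<^sub>v u \<in> (\<Union>m. filt m)" by auto
qed

lemma v_cyclic: "v \<in> cyclic"
  unfolding cyclic_def using level_filt[OF hw_vector] by blast

lemma cyclic_stable:
  assumes "u \<in> cyclic" "e \<in> signs" "i \<in> I0"
  shows "x e i r *\<^sub>v u \<in> cyclic" "\<psi> e i r *\<^sub>v u \<in> cyclic"
proof -
  from assms obtain m where u: "u \<in> filt m" by (auto simp: cyclic_def)
  show "\<psi> e i r *\<^sub>v u \<in> cyclic" using psi_filt[OF u assms(2,3)] by (auto simp: cyclic_def)
  have "e = 1 \<or> e = - 1" using assms(2) by (auto simp: signs_def)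
  then show "x e i r *\<^sub>v u \<in> cyclic"
    using raise_filt[OF u assms(3)] lower_filt[OF u assms(3)] unfolding cyclic_def by blast
qed

lemma q_power_inj: "inverse q ^ m = inverse q ^ k \<longleftrightarrow> m = k"
  using powi_inj[OF q_nonzero q_generic, of "int m" "int k"] by (simp add: power_inverse)

text \<open>
  The levels consist of eigenvectors of \<open>K\<close> for pairwise different eigenvalues. If \<open>\<nu>\<close> is the eigenvalue of the
  top level, applying \<open>K - \<nu>\<close> to \<open>u\<close> removes its top component and scales \<open>u\<close> by \<open>\<mu> - \<nu>\<close>, so either \<open>u\<close>
  lies in lower levels, or \<open>\<mu> = \<nu>\<close> and the rest of \<open>u\<close>, having the eigenvalue \<open>\<nu>\<close> in lower levels, vanishes.
\<close>

lemma eigenvector_in_level: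
  "u \<in> filt m \<Longrightarrow> u \<noteq> 0\<^sub>v N \<Longrightarrow> K u = \<mu> \<cdot>\<^sub>v u \<Longrightarrow>
    \<exists>k\<le>m. \<mu> = top_weight * inverse q ^ k \<and> level k u"
proof (induction m arbitrary: u \<mu>)
  case 0
  then have "level 0 u" by simp
  have "top_weight \<cdot>\<^sub>v u = \<mu> \<cdot>\<^sub>v u" using K_level[OF \<open>level 0 u\<close>] 0 by simp
  have "\<mu> = top_weight"
  proof (rule ccontr)
    assume ne: "\<mu> \<noteq> top_weight"
    have "u $ j = 0" if "j < N" for j
      using arg_cong[OF \<open>top_weight \<cdot>\<^sub>v u = \<mu> \<cdot>\<^sub>v u\<close>, of "\<lambda>w. w $ j"] ne that
        level_carrier[OF \<open>level 0 u\<close>] by auto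
    then show False using 0 level_carrier[OF \<open>level 0 u\<close>] by auto
  qed
  then show ?case using \<open>level 0 u\<close> by auto
next
  case (Suc m)
  then obtain u1 u2 where d: "u = u1 + u2" "u1 \<in> filt m" "level (Suc m) u2" by auto
  have car: "u1 \<in> carrier_vec N" "u2 \<in> carrier_vec N" "u \<in> carrier_vec N" "K u1 \<in> carrier_vec N"
    using d filt_carrier level_carrier by auto
  define \<nu> where "\<nu> = top_weight * inverse q ^ Suc m"
  have K2: "K u2 = \<nu> \<cdot>\<^sub>v u2" using K_level[OF d(3)] by (simp add: \<nu>_def)
  define w where "w = K u1 - \<nu> \<cdot>\<^sub>v u1"
  have w: "w \<in> filt m"
    unfolding w_def K_def using d psi_filt
    by (intro lin_closed_diff[OF lin_closed_filt] lin_closedD(4)[OF lin_closed_filt]) auto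
  have Ku: "K u1 + \<nu> \<cdot>\<^sub>v u2 = \<mu> \<cdot>\<^sub>v u" using Suc.prems(3) d car by (simp add: K_add K2)
  have w_eq: "w = (\<mu> - \<nu>) \<cdot>\<^sub>v u"
  proof (rule eq_vecI)
    fix j assume "j < dim_vec ((\<mu> - \<nu>) \<cdot>\<^sub>v u)"
    then have "j < N" using car by simp
    then show "w $ j = ((\<mu> - \<nu>) \<cdot>\<^sub>v u) $ j"
      using arg_cong[OF Ku, of "\<lambda>w. w $ j"] car
      by (simp add: w_def d algebra_simps)
  qed (use w filt_carrier car in auto)
  show ?case
  proof (cases "\<mu> = \<nu>")
    case True
    have "K u1 = \<nu> \<cdot>\<^sub>v u1"
    proof (rule eq_vecI)
      fix j assume "j < dim_vec (\<nu> \<cdot>\<^sub>v u1)"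
      then have "j < N" using car by simp
      then show "K u1 $ j = (\<nu> \<cdot>\<^sub>v u1) $ j"
        using arg_cong[OF w_eq, of "\<lambda>w. w $ j"] car True by (simp add: w_def)
    qed (use car in auto)
    have "u1 = 0\<^sub>v N"
    proof (rule ccontr)
      assume "u1 \<noteq> 0\<^sub>v N"
      from Suc.IH[OF d(2) this \<open>K u1 = \<nu> \<cdot>\<^sub>v u1\<close>]
      obtain k where "k \<le> m" "\<nu> = top_weight * inverse q ^ k" by auto
      then have "inverse q ^ Suc m = inverse q ^ k"
        using top_weight_nonzero by (simp add: \<nu>_def del: power_Suc)
      then show False using \<open>k \<le> m\<close> unfolding q_power_inj by simp
    qed
    then have "u = u2" using d car by simp
    then show ?thesis using d True by (auto simp: \<nu>_def)
  next
    case False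
    have "u = inverse (\<mu> - \<nu>) \<cdot>\<^sub>v w"
      unfolding w_eq using False by (simp add: smult_smult_assoc)
    then have "u \<in> filt m" using w lin_closedD(4)[OF lin_closed_filt] by auto
    from Suc.IH[OF this Suc.prems(2,3)] show ?thesis using le_SucI by blast
  qed
qed

lemma cyclic_eigenvector:
  assumes "u \<in> cyclic" "u \<noteq> 0\<^sub>v N" "K u = \<mu> \<cdot>\<^sub>v u"
  shows "\<exists>k. \<mu> = top_weight * inverse q ^ k \<and> level k u"
proof -
  from assms(1) obtain m where "u \<in> filt m" by (auto simp: cyclic_def)
  from eigenvector_in_level[OF this assms(2,3)] show ?thesis by blast
qed

lemma cyclic_top_eigenvector:
  assumes "u \<in> cyclic" "K u = top_weight \<cdot>\<^sub>v u"
  shows "\<exists>c. u = c \<cdot>\<^sub>v v"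
proof (cases "u = 0\<^sub>v N")
  case True
  have "0 \<cdot>\<^sub>v v = 0\<^sub>v N" using v by auto
  then show ?thesis using True by metis
next
  case False
  from cyclic_eigenvector[OF assms(1) this assms(2)]
  obtain k where k: "top_weight = top_weight * inverse q ^ k" "level k u" by blast
  then have "inverse q ^ k = inverse q ^ 0" using top_weight_nonzero by simp
  then have "k = 0" unfolding q_power_inj .
  then show ?thesis using level_0D[OF k(2)] by simp
qed

lemma simple_cyclic:
  assumes "simple_module V"
  shows "cyclic = carrier_vec N"
proof -
  have "cyclic = {0\<^sub>v N} \<or> cyclic = carrier_vec N"
    using assms lin_closed_cyclic cyclic_stable
    unfolding simple_module_def subspace_iff_lin_closed by blast
  then show ?thesis using v_cyclic v_nonzero by auto
qed

lemma eigenvalue_vanishes: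
  assumes "e \<in> signs" "i \<in> I0" "e * r < 0"
  shows "\<kappa> e i r = 0"
proof (rule ccontr)
  assume ne: "\<kappa> e i r \<noteq> 0"
  have "\<kappa> e i r \<cdot>\<^sub>v v = 0\<^sub>v N"
    using psi_v[OF assms(1,2), of r] psi_vanishes[OF loop assms] zero_mat_vec[OF v, of N] by simp
  then have "inverse (\<kappa> e i r) \<cdot>\<^sub>v (\<kappa> e i r \<cdot>\<^sub>v v) = 0\<^sub>v N" by (simp add: smult_zero_vecs)
  then show False using ne v_nonzero by (simp add: smult_smult_assoc)
qed

lemma highest_weight_shift:
  assumes "simple_module V" "hw_rep q V w \<mu>"
  shows "\<exists>k. hw_rep.top_weight \<mu> = top_weight * inverse q ^ k \<and> level k w"
proof -
  interpret W: hw_rep q V w \<mu> by (rule assms(2))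
  have "K w = W.top_weight \<cdot>\<^sub>v w"
    using W.K_level[OF W.hw_vector] by (simp add: K_def W.K_def)
  then show ?thesis
    using cyclic_eigenvector[of w] W.v W.v_nonzero simple_cyclic[OF assms(1)] by simp
qed

text \<open>
  Each of the two vectors lies in some level of the module generated by the other one. So the eigenvalue
  of \<open>K\<close> on \<open>w\<close> is \<open>q\<^sup>-\<^sup>k\<close> times that on \<open>v\<close>, and the eigenvalue on \<open>v\<close> is \<open>q\<^sup>-\<^sup>l\<close> times that on \<open>w\<close>. Hence
  \<open>k = l = 0\<close>, and the vectors are proportional.
\<close>

lemma highest_weight_unique:
  assumes "simple_module V" "hw_rep q V w \<mu>" "e \<in> signs" "i \<in> I0"
  shows "\<mu> e i = \<kappa> e i"
proof
  fix r
  interpret W: hw_rep q V w \<mu> by (rule assms(2))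
  obtain k where k: "W.top_weight = top_weight * inverse q ^ k" "level k w"
    using highest_weight_shift[OF assms(1,2)] by blast
  obtain l where l: "top_weight = W.top_weight * inverse q ^ l"
    using W.highest_weight_shift[OF assms(1) hw_rep_axioms] by blast
  have "top_weight * inverse q ^ (k + l) = top_weight * inverse q ^ 0"
    using l[unfolded k(1)] by (simp add: power_add mult.assoc)
  then have "inverse q ^ (k + l) = inverse q ^ 0"
    using top_weight_nonzero unfolding mult_cancel_left by blast
  then have "k + l = 0" unfolding q_power_inj .
  then obtain c where c: "w = c \<cdot>\<^sub>v v" using level_0D[OF k(2)] by auto
  have eq: "\<mu> e i r \<cdot>\<^sub>v w = \<kappa> e i r \<cdot>\<^sub>v w"
    using W.psi_v[OF assms(3,4), of r] psi_v[OF assms(3,4), of r] assms(3,4) v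
    unfolding c by (simp add: mult_mat_vec[of _ N N] smult_smult_assoc mult.commute)
  obtain j where j: "j < N" "w $ j \<noteq> 0"
    using W.v W.v_nonzero by (metis carrier_vecD eq_vecI index_zero_vec)
  have "(\<mu> e i r \<cdot>\<^sub>v w) $ j = (\<kappa> e i r \<cdot>\<^sub>v w) $ j" unfolding eq ..
  then show "\<mu> e i r = \<kappa> e i r" using j W.v by simp
qed

end

section \<open>Direct sums\<close>

definition block :: "nat \<Rightarrow> nat \<Rightarrow> 'k::field mat \<Rightarrow> 'k mat \<Rightarrow> 'k mat" where
  "block n m A B = four_block_mat A (0\<^sub>m n m) (0\<^sub>m m n) B"

lemma block_carrier [simp]:
  "A \<in> carrier_mat n n \<Longrightarrow> B \<in> carrier_mat m m \<Longrightarrow> block n m A B \<in> carrier_mat (n + m) (n + m)"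
  by (simp add: block_def)

lemma block_zero: "block n m (0\<^sub>m n n) (0\<^sub>m m m) = 0\<^sub>m (n + m) (n + m)"
  by (simp add: block_def)

lemma block_one: "block n m (1\<^sub>m n) (1\<^sub>m m) = 1\<^sub>m (n + m)"
  by (simp add: block_def)

lemma block_ops:
  assumes "A \<in> carrier_mat n n" "A' \<in> carrier_mat n n" "B \<in> carrier_mat m m" "B' \<in> carrier_mat m m"
  shows "block n m A B * block n m A' B' = block n m (A * A') (B * B')"
    and "block n m A B + block n m A' B' = block n m (A + A') (B + B')"
    and "block n m A B - block n m A' B' = block n m (A - A') (B - B')"
proof -
  show "block n m A B * block n m A' B' = block n m (A * A') (B * B')"
    unfolding block_def using assms
    by (subst mult_four_block_mat[of _ n n _ m _ m _ _ n _ m]) auto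
  show "block n m A B + block n m A' B' = block n m (A + A') (B + B')"
    unfolding block_def using assms by (subst add_four_block_mat[of _ n n _ m _ m]) auto
  show "block n m A B - block n m A' B' = block n m (A - A') (B - B')"
    unfolding block_def using assms by (intro eq_matI) auto
qed

lemma block_smult:
  assumes "A \<in> carrier_mat n n" "B \<in> carrier_mat m m"
  shows "c \<cdot>\<^sub>m block n m A B = block n m (c \<cdot>\<^sub>m A) (c \<cdot>\<^sub>m B)"
  unfolding block_def using assms by (intro eq_matI) auto

lemma block_mult_vec:
  assumes "A \<in> carrier_mat n n" "B \<in> carrier_mat m m" "a \<in> carrier_vec n" "b \<in> carrier_vec m"
  shows "block n m A B *\<^sub>v (a @\<^sub>v b) = (A *\<^sub>v a) @\<^sub>v (B *\<^sub>v b)"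
  unfolding block_def by (rule mult_mat_vec_split[OF assms])

definition direct_sum :: "'k::field loop_mod \<Rightarrow> 'k loop_mod \<Rightarrow> 'k loop_mod" where
  "direct_sum V W = \<lparr>mdim = mdim V + mdim W,
     xop = \<lambda>e i r. block (mdim V) (mdim W) (xop V e i r) (xop W e i r),
     psi = \<lambda>e i r. block (mdim V) (mdim W) (psi V e i r) (psi W e i r)\<rparr>"

lemma direct_sum_simps [simp]:
  "mdim (direct_sum V W) = mdim V + mdim W"
  "xop (direct_sum V W) e i r = block (mdim V) (mdim W) (xop V e i r) (xop W e i r)"
  "psi (direct_sum V W) e i r = block (mdim V) (mdim W) (psi V e i r) (psi W e i r)"
  by (simp_all add: direct_sum_def)

lemma loop_module_direct_sum:
  assumes V: "loop_module q V" and W: "loop_module q W"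
  shows "loop_module q (direct_sum V W)"
proof -
  have s: "1 \<in> signs" "- 1 \<in> signs" by (auto simp: signs_def)
  have mult: "A * B \<in> carrier_mat k k" if "A \<in> carrier_mat k k" "B \<in> carrier_mat k k"
    for A B :: "'a mat" and k using that by simp
  note [simp] = s loop_moduleD(1,2)[OF V] loop_moduleD(1,2)[OF W] mult minus_carrier_mat
    block_ops block_smult
  note serre = serre[OF V, unfolded serre_term_def] serre[OF W, unfolded serre_term_def]
  show ?thesis
    unfolding loop_module_def Let_def serre_term_def direct_sum_simps
  proof ((intro conjI; (intro ballI allI impI)?), goal_cases)
    case 1 then show ?case by simp
  next
    case (2 e i r) then show ?case
      using psi_vanishes[OF V 2] psi_vanishes[OF W 2] by (simp add: block_zero)
  next
    case 3 then show ?case by (simp add: psi_inverse[OF V] psi_inverse[OF W] block_one)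
  next
    case (4 e e' i j r s)
    then show ?case using psi_commute[OF V 4] psi_commute[OF W 4] by simp
  next
    case (5 e' e i j r s)
    then show ?case using psi_xop[OF V 5] psi_xop[OF W 5] by simp
  next
    case (6 e i j r s)
    then show ?case using xop_xop[OF V 6] xop_xop[OF W 6] by simp
  next
    case (7 i j r s)
    then show ?case
      using xop_plus_minus[OF V 7, of r s] xop_plus_minus[OF W 7, of r s] by (simp add: block_zero)
  next
    case (8 e i j r r' s)
    then show ?case using serre(1)[OF 8] serre(2)[OF 8] by (simp add: block_zero)
  qed
qed

section \<open>Simple modules with the same highest weight\<close>

text \<open>
  The submodule \<open>S\<close> of \<open>V \<oplus> W\<close> generated by \<open>(v, w)\<close> is the graph of an isomorphism. By simplicity it projects
  onto both summands. Its intersection with \<open>W\<close> is a submodule of \<open>W\<close>; it does not contain \<open>w\<close>, because the only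
  vectors in \<open>S\<close> with the \<open>K\<close>-eigenvalue of \<open>(v, w)\<close> are the multiples of \<open>(v, w)\<close>. So this intersection is \<open>0\<close>,
  and the same holds for \<open>V\<close>.
\<close>

lemma iso_of_common_highest_weight:
  fixes q :: "'k::field_char_0"
  assumes V: "hw_rep q V v \<kappa>" "simple_module V" and W: "hw_rep q W w \<kappa>" "simple_module W"
  shows "iso_mod V W"
proof -
  interpret V: hw_rep q V v \<kappa> by (rule V(1))
  interpret W: hw_rep q W w \<kappa> by (rule W(1))
  let ?n = "mdim V" and ?m = "mdim W"
  have zero: "0\<^sub>v ?n @\<^sub>v 0\<^sub>v ?m = (0\<^sub>v (?n + ?m) :: 'k vec)" by (intro eq_vecI) auto
  have append_smult: "c \<cdot>\<^sub>v (a @\<^sub>v b) = (c \<cdot>\<^sub>v a) @\<^sub>v (c \<cdot>\<^sub>v b)"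
    if "a \<in> carrier_vec ?n" "b \<in> carrier_vec ?m" for a b :: "'k vec" and c
    using that by (intro eq_vecI) auto
  interpret VW: hw_rep q "direct_sum V W" "v @\<^sub>v w" \<kappa>
  proof
    show "loop_module q (direct_sum V W)" by (rule loop_module_direct_sum[OF V.loop W.loop])
    show "v @\<^sub>v w \<in> carrier_vec (mdim (direct_sum V W))" using V.v W.v by simp
    show "v @\<^sub>v w \<noteq> 0\<^sub>v (mdim (direct_sum V W))"
      using V.v W.v V.v_nonzero by (simp flip: zero)
    show "xop (direct_sum V W) 1 i r *\<^sub>v (v @\<^sub>v w) = 0\<^sub>v (mdim (direct_sum V W))"
      if "i \<in> I0" for i r
      using that V.v W.v by (simp add: block_mult_vec V.hw W.hw zero)
    show "psi (direct_sum V W) e i r *\<^sub>v (v @\<^sub>v w) = \<kappa> e i r \<cdot>\<^sub>v (v @\<^sub>v w)"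
      if "e \<in> signs" "i \<in> I0" for e i r
      using that V.v W.v by (simp add: block_mult_vec V.psi_v W.psi_v append_smult)
  qed (rule V.q_nonzero V.q_generic; assumption?)+
  let ?S = "VW.cyclic"
  note S = VW.lin_closed_cyclic[simplified]
  note S_mem = lin_closedD[OF S]
  have stable: "(xop V e i r *\<^sub>v a) @\<^sub>v (xop W e i r *\<^sub>v b) \<in> ?S"
    "(psi V e i r *\<^sub>v a) @\<^sub>v (psi W e i r *\<^sub>v b) \<in> ?S"
    if "a @\<^sub>v b \<in> ?S" "e \<in> signs" "i \<in> I0" "a \<in> carrier_vec ?n" "b \<in> carrier_vec ?m" for a b e i r
    using VW.cyclic_stable[OF that(1-3), of r] that by (simp_all add: block_mult_vec)
  have sub_V: "U = {0\<^sub>v ?n} \<or> U = carrier_vec ?n"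
    if "lin_closed ?n U"
      "\<And>e i r u. e \<in> signs \<Longrightarrow> i \<in> I0 \<Longrightarrow> u \<in> U \<Longrightarrow> xop V e i r *\<^sub>v u \<in> U \<and> psi V e i r *\<^sub>v u \<in> U"
    for U
    using V(2) that unfolding simple_module_def subspace_iff_lin_closed by blast
  have sub_W: "U = {0\<^sub>v ?m} \<or> U = carrier_vec ?m"
    if "lin_closed ?m U"
      "\<And>e i r u. e \<in> signs \<Longrightarrow> i \<in> I0 \<Longrightarrow> u \<in> U \<Longrightarrow> xop W e i r *\<^sub>v u \<in> U \<and> psi W e i r *\<^sub>v u \<in> U"
    for U
    using W(2) that unfolding simple_module_def subspace_iff_lin_closed by blast
  have add: "(a + a') @\<^sub>v (b + b') \<in> ?S"
    if "a @\<^sub>v b \<in> ?S" "a' @\<^sub>v b' \<in> ?S" "a \<in> carrier_vec ?n" "b \<in> carrier_vec ?m"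
      "a' \<in> carrier_vec ?n" "b' \<in> carrier_vec ?m" for a a' b b'
    using S_mem(3)[OF that(1,2)] append_vec_add[OF that(3,5,4,6)] by simp
  have smult: "(c \<cdot>\<^sub>v a) @\<^sub>v (c \<cdot>\<^sub>v b) \<in> ?S"
    if "a @\<^sub>v b \<in> ?S" "a \<in> carrier_vec ?n" "b \<in> carrier_vec ?m" for a b c
    using S_mem(4)[OF that(1)] append_smult[OF that(2,3)] by simp
  have zero_mem: "0\<^sub>v ?n @\<^sub>v 0\<^sub>v ?m \<in> ?S" using S_mem(2) by (simp add: zero)
  note vw = VW.v_cyclic V.v W.v
  have left: "\<forall>a\<in>carrier_vec ?n. \<exists>b\<in>carrier_vec ?m. a @\<^sub>v b \<in> ?S"
  proof
    fix a :: "'k vec" assume a: "a \<in> carrier_vec ?n"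
    let ?U = "{a \<in> carrier_vec ?n. \<exists>b\<in>carrier_vec ?m. a @\<^sub>v b \<in> ?S}"
    have "lin_closed ?n ?U"
      unfolding lin_closed_def
    proof (intro conjI ballI allI)
      show "0\<^sub>v ?n \<in> ?U" using zero_mem by (auto intro: bexI[of _ "0\<^sub>v ?m"])
    next
      fix a a' assume "a \<in> ?U" "a' \<in> ?U"
      then obtain b b' where "a \<in> carrier_vec ?n" "a' \<in> carrier_vec ?n"
        "b \<in> carrier_vec ?m" "b' \<in> carrier_vec ?m" "a @\<^sub>v b \<in> ?S" "a' @\<^sub>v b' \<in> ?S" by auto
      then show "a + a' \<in> ?U" using add[of a b a' b'] by (auto intro!: bexI[of _ "b + b'"])
    next
      fix c a assume "a \<in> ?U"
      then obtain b where "a \<in> carrier_vec ?n" "b \<in> carrier_vec ?m" "a @\<^sub>v b \<in> ?S" by auto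
      then show "c \<cdot>\<^sub>v a \<in> ?U" using smult[of a b c] by (auto intro!: bexI[of _ "c \<cdot>\<^sub>v b"])
    qed auto
    then have "?U = {0\<^sub>v ?n} \<or> ?U = carrier_vec ?n"
    proof (rule sub_V)
      fix e i r a assume ei: "e \<in> signs" "i \<in> I0" and "a \<in> ?U"
      then obtain b where "a \<in> carrier_vec ?n" "b \<in> carrier_vec ?m" "a @\<^sub>v b \<in> ?S" by auto
      then show "xop V e i r *\<^sub>v a \<in> ?U \<and> psi V e i r *\<^sub>v a \<in> ?U"
        using stable[of a b e i r] ei V.vec_carrier[OF ei] W.vec_carrier[OF ei, of b] by blast
    qed
    moreover have "v \<in> ?U" using vw by blast
    ultimately show "\<exists>b\<in>carrier_vec ?m. a @\<^sub>v b \<in> ?S" using V.v_nonzero a by blast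
  qed
  have right: "\<forall>b\<in>carrier_vec ?m. \<exists>a\<in>carrier_vec ?n. a @\<^sub>v b \<in> ?S"
  proof
    fix b :: "'k vec" assume b: "b \<in> carrier_vec ?m"
    let ?U = "{b \<in> carrier_vec ?m. \<exists>a\<in>carrier_vec ?n. a @\<^sub>v b \<in> ?S}"
    have "lin_closed ?m ?U"
      unfolding lin_closed_def
    proof (intro conjI ballI allI)
      show "0\<^sub>v ?m \<in> ?U" using zero_mem by (auto intro: bexI[of _ "0\<^sub>v ?n"])
    next
      fix b b' assume "b \<in> ?U" "b' \<in> ?U"
      then obtain a a' where "b \<in> carrier_vec ?m" "b' \<in> carrier_vec ?m"
        "a \<in> carrier_vec ?n" "a' \<in> carrier_vec ?n" "a @\<^sub>v b \<in> ?S" "a' @\<^sub>v b' \<in> ?S" by auto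
      then show "b + b' \<in> ?U" using add[of a b a' b'] by (auto intro!: bexI[of _ "a + a'"])
    next
      fix c b assume "b \<in> ?U"
      then obtain a where "b \<in> carrier_vec ?m" "a \<in> carrier_vec ?n" "a @\<^sub>v b \<in> ?S" by auto
      then show "c \<cdot>\<^sub>v b \<in> ?U" using smult[of a b c] by (auto intro!: bexI[of _ "c \<cdot>\<^sub>v a"])
    qed auto
    then have "?U = {0\<^sub>v ?m} \<or> ?U = carrier_vec ?m"
    proof (rule sub_W)
      fix e i r b assume ei: "e \<in> signs" "i \<in> I0" and "b \<in> ?U"
      then obtain a where "a \<in> carrier_vec ?n" "b \<in> carrier_vec ?m" "a @\<^sub>v b \<in> ?S" by auto
      then show "xop W e i r *\<^sub>v b \<in> ?U \<and> psi W e i r *\<^sub>v b \<in> ?U"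
        using stable[of a b e i r] ei V.vec_carrier[OF ei, of a] W.vec_carrier[OF ei] by blast
    qed
    moreover have "w \<in> ?U" using vw by blast
    ultimately show "\<exists>a\<in>carrier_vec ?n. a @\<^sub>v b \<in> ?S" using W.v_nonzero b by blast
  qed
  have top: "c \<cdot>\<^sub>v v = a \<and> c \<cdot>\<^sub>v w = b" if "a @\<^sub>v b = c \<cdot>\<^sub>v (v @\<^sub>v w)" "a \<in> carrier_vec ?n" for a b c
    using that append_smult[OF vw(2,3), of c] vw append_vec_eq[of a ?n "c \<cdot>\<^sub>v v"] by auto
  have K: "VW.K (a @\<^sub>v b) = V.K a @\<^sub>v W.K b" if "a \<in> carrier_vec ?n" "b \<in> carrier_vec ?m" for a b
    using that by (simp add: VW.K_def V.K_def W.K_def block_mult_vec)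
  have Kv: "V.K v = VW.top_weight \<cdot>\<^sub>v v" and Kw: "W.K w = VW.top_weight \<cdot>\<^sub>v w"
    using V.K_level[OF V.hw_vector] W.K_level[OF W.hw_vector]
    by (simp_all add: V.top_weight_def W.top_weight_def VW.top_weight_def)
  have K0: "V.K (0\<^sub>v ?n) = 0\<^sub>v ?n" "W.K (0\<^sub>v ?m) = 0\<^sub>v ?m"
    by (simp_all add: V.K_def W.K_def)
  have left_kernel: "\<forall>b\<in>carrier_vec ?m. 0\<^sub>v ?n @\<^sub>v b \<in> ?S \<longrightarrow> b = 0\<^sub>v ?m"
  proof (intro ballI impI)
    fix b :: "'k vec" assume b: "b \<in> carrier_vec ?m" "0\<^sub>v ?n @\<^sub>v b \<in> ?S"
    let ?U = "{b \<in> carrier_vec ?m. 0\<^sub>v ?n @\<^sub>v b \<in> ?S}"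
    have "lin_closed ?m ?U"
      unfolding lin_closed_def using zero_mem add[of "0\<^sub>v ?n" _ "0\<^sub>v ?n"] smult[of "0\<^sub>v ?n"]
      by (auto simp: smult_zero_vecs)
    then have "?U = {0\<^sub>v ?m} \<or> ?U = carrier_vec ?m"
    proof (rule sub_W)
      fix e i r b assume "e \<in> signs" "i \<in> I0" "b \<in> ?U"
      then show "xop W e i r *\<^sub>v b \<in> ?U \<and> psi W e i r *\<^sub>v b \<in> ?U"
        using stable[of "0\<^sub>v ?n" b e i r] by simp
    qed
    moreover have "w \<notin> ?U"
    proof
      assume "w \<in> ?U"
      then have mem: "0\<^sub>v ?n @\<^sub>v w \<in> ?S" by simp
      have "VW.K (0\<^sub>v ?n @\<^sub>v w) = VW.top_weight \<cdot>\<^sub>v (0\<^sub>v ?n @\<^sub>v w)"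
        using vw by (simp add: K Kw K0 append_smult smult_zero_vecs)
      from VW.cyclic_top_eigenvector[OF mem this] obtain c where
        "0\<^sub>v ?n @\<^sub>v w = c \<cdot>\<^sub>v (v @\<^sub>v w)" by blast
      from top[OF this] have c: "c \<cdot>\<^sub>v v = 0\<^sub>v ?n" "c \<cdot>\<^sub>v w = w" by auto
      have "c = 0"
      proof (rule ccontr)
        assume "c \<noteq> 0"
        then have "v = inverse c \<cdot>\<^sub>v (c \<cdot>\<^sub>v v)" by (simp add: smult_smult_assoc)
        then show False using c V.v_nonzero by (simp add: smult_zero_vecs)
      qed
      then show False using c(2) W.v W.v_nonzero smult_zero_vecs(1)[OF W.v] by simp
    qed
    ultimately show "b = 0\<^sub>v ?m" using vw b by blast
  qed
  have right_kernel: "\<forall>a\<in>carrier_vec ?n. a @\<^sub>v 0\<^sub>v ?m \<in> ?S \<longrightarrow> a = 0\<^sub>v ?n"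
  proof (intro ballI impI)
    fix a :: "'k vec" assume a: "a \<in> carrier_vec ?n" "a @\<^sub>v 0\<^sub>v ?m \<in> ?S"
    let ?U = "{a \<in> carrier_vec ?n. a @\<^sub>v 0\<^sub>v ?m \<in> ?S}"
    have "lin_closed ?n ?U"
      unfolding lin_closed_def using zero_mem add[of _ "0\<^sub>v ?m" _ "0\<^sub>v ?m"] smult[of _ "0\<^sub>v ?m"]
      by (auto simp: smult_zero_vecs)
    then have "?U = {0\<^sub>v ?n} \<or> ?U = carrier_vec ?n"
    proof (rule sub_V)
      fix e i r a assume "e \<in> signs" "i \<in> I0" "a \<in> ?U"
      then show "xop V e i r *\<^sub>v a \<in> ?U \<and> psi V e i r *\<^sub>v a \<in> ?U"
        using stable[of a "0\<^sub>v ?m" e i r] by simp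
    qed
    moreover have "v \<notin> ?U"
    proof
      assume "v \<in> ?U"
      then have mem: "v @\<^sub>v 0\<^sub>v ?m \<in> ?S" by simp
      have "VW.K (v @\<^sub>v 0\<^sub>v ?m) = VW.top_weight \<cdot>\<^sub>v (v @\<^sub>v 0\<^sub>v ?m)"
        using vw by (simp add: K Kv K0 append_smult smult_zero_vecs)
      from VW.cyclic_top_eigenvector[OF mem this] obtain c where
        "v @\<^sub>v 0\<^sub>v ?m = c \<cdot>\<^sub>v (v @\<^sub>v w)" by blast
      from top[OF this] have c: "c \<cdot>\<^sub>v v = v" "c \<cdot>\<^sub>v w = 0\<^sub>v ?m" using vw by auto
      have "c = 0"
      proof (rule ccontr)
        assume "c \<noteq> 0"
        then have "w = inverse c \<cdot>\<^sub>v (c \<cdot>\<^sub>v w)" by (simp add: smult_smult_assoc)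
        then show False using c W.v_nonzero by (simp add: smult_zero_vecs)
      qed
      then show False using c(1) V.v V.v_nonzero smult_zero_vecs(1)[OF V.v] by simp
    qed
    ultimately show "a = 0\<^sub>v ?n" using vw a by blast
  qed
  obtain P where P: "?n = ?m" "P \<in> carrier_mat ?n ?n" "invertible_mat P"
    "\<forall>a\<in>carrier_vec ?n. a @\<^sub>v (P *\<^sub>v a) \<in> ?S"
    "\<forall>a\<in>carrier_vec ?n. \<forall>b\<in>carrier_vec ?m. a @\<^sub>v b \<in> ?S \<longrightarrow> b = P *\<^sub>v a"
    using graph_of_isomorphism[OF S left right left_kernel right_kernel]
    by (elim exE conjE) (rule that)
  note graph = P(4)[rule_format] and unique = P(5)[rule_format]
  have Pvec: "P *\<^sub>v a \<in> carrier_vec ?m" for a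
    using P(1,2) by (intro carrier_vecI; simp)+
  have inter: "P * A = B * P"
    if A: "A \<in> carrier_mat ?n ?n" and B: "B \<in> carrier_mat ?m ?m"
      and AB: "\<And>a. a \<in> carrier_vec ?n \<Longrightarrow> (A *\<^sub>v a) @\<^sub>v (B *\<^sub>v (P *\<^sub>v a)) \<in> ?S" for A B
  proof (rule mat_vec_eqI)
    fix a :: "'k vec" assume a: "a \<in> carrier_vec ?n"
    have "B *\<^sub>v (P *\<^sub>v a) = P *\<^sub>v (A *\<^sub>v a)"
      using unique[OF _ _ AB[OF a]] A B a Pvec by simp
    then show "(P * A) *\<^sub>v a = (B * P) *\<^sub>v a"
      using P(1,2) A B a by (simp add: assoc_mult_mat_vec[of _ ?n ?n _ ?n])
  qed (use P(1,2) A B in auto)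
  show ?thesis
    unfolding iso_mod_def
  proof (intro conjI bexI[OF _ P(2)] ballI allI)
    fix e i r assume ei: "e \<in> signs" "i \<in> I0"
    show "P * xop V e i r = xop W e i r * P" "P * psi V e i r = psi W e i r * P"
      using stable[OF graph ei _ Pvec, of _ r] ei by (intro inter; simp)+
  qed (rule P(1) P(3))+
qed

section \<open>Isomorphism classes\<close>

lemma iso_modE:
  assumes "iso_mod V W"
  obtains P Q where "mdim W = mdim V" "P \<in> carrier_mat (mdim V) (mdim V)"
    "Q \<in> carrier_mat (mdim V) (mdim V)" "P * Q = 1\<^sub>m (mdim V)" "Q * P = 1\<^sub>m (mdim V)"
    "\<forall>e\<in>signs. \<forall>i\<in>I0. \<forall>r.
      P * xop V e i r = xop W e i r * P \<and> P * psi V e i r = psi W e i r * P"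
proof -
  obtain P where P: "mdim W = mdim V" "P \<in> carrier_mat (mdim V) (mdim V)" "invertible_mat P"
    "\<forall>e\<in>signs. \<forall>i\<in>I0. \<forall>r.
      P * xop V e i r = xop W e i r * P \<and> P * psi V e i r = psi W e i r * P"
    using assms unfolding iso_mod_def by auto
  obtain Q where "Q \<in> carrier_mat (mdim V) (mdim V)" "P * Q = 1\<^sub>m (mdim V)"
    "Q * P = 1\<^sub>m (mdim V)"
    using P(3) unfolding invertible_mat_iff[OF P(2)] by auto
  from that[OF P(1,2) this P(4)] show thesis .
qed

lemma iso_modI:
  assumes "mdim W = mdim V" "P \<in> carrier_mat (mdim V) (mdim V)" "Q \<in> carrier_mat (mdim V) (mdim V)"
    "P * Q = 1\<^sub>m (mdim V)" "Q * P = 1\<^sub>m (mdim V)"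
    "\<And>e i r. e \<in> signs \<Longrightarrow> i \<in> I0 \<Longrightarrow> P * xop V e i r = xop W e i r * P"
    "\<And>e i r. e \<in> signs \<Longrightarrow> i \<in> I0 \<Longrightarrow> P * psi V e i r = psi W e i r * P"
  shows "iso_mod V W"
  unfolding iso_mod_def using assms invertible_mat_iff[OF assms(2)]
  by (intro conjI bexI[OF _ assms(2)]) auto

lemma iso_mod_refl:
  assumes "loop_module q V"
  shows "iso_mod V V"
proof (rule iso_modI[of _ _ "1\<^sub>m (mdim V)" "1\<^sub>m (mdim V)"])
  fix e i r assume ei: "e \<in> signs" "i \<in> I0"
  show "1\<^sub>m (mdim V) * xop V e i r = xop V e i r * 1\<^sub>m (mdim V)"
    "1\<^sub>m (mdim V) * psi V e i r = psi V e i r * 1\<^sub>m (mdim V)"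
    using loop_moduleD(1,2)[OF assms ei, of r] by simp_all
qed auto

lemma iso_mod_sym:
  assumes V: "loop_module q V" and W: "loop_module q W" and iso: "iso_mod V W"
  shows "iso_mod W V"
proof -
  let ?n = "mdim V"
  obtain P Q where n: "mdim W = ?n"
    and P: "P \<in> carrier_mat ?n ?n" and Q: "Q \<in> carrier_mat ?n ?n"
    and PQ: "P * Q = 1\<^sub>m ?n" and QP: "Q * P = 1\<^sub>m ?n"
    and int: "\<forall>e\<in>signs. \<forall>i\<in>I0. \<forall>r.
      P * xop V e i r = xop W e i r * P \<and> P * psi V e i r = psi W e i r * P"
    using iso by (rule iso_modE)
  have inv: "Q * B = A * Q"
    if AB: "P * A = B * P" and A: "A \<in> carrier_mat ?n ?n" and B: "B \<in> carrier_mat ?n ?n" for A B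
  proof -
    have "Q * B = Q * (B * (P * Q))" using B PQ by simp
    also have "\<dots> = Q * ((B * P) * Q)" using P Q B by (simp add: assoc_mult_mat[of _ ?n ?n _ ?n _ ?n])
    also have "\<dots> = (Q * P) * (A * Q)"
      unfolding AB[symmetric] using P Q A by (simp add: assoc_mult_mat[of _ ?n ?n _ ?n _ ?n])
    also have "\<dots> = A * Q" unfolding QP using A Q by simp
    finally show ?thesis .
  qed
  show ?thesis
  proof (rule iso_modI[of _ _ Q P])
    fix e i r assume ei: "e \<in> signs" "i \<in> I0"
    show "Q * xop W e i r = xop V e i r * Q"
      using int[rule_format, OF ei] loop_moduleD(1)[OF V ei] loop_moduleD(1)[OF W ei] n by (intro inv) auto
    show "Q * psi W e i r = psi V e i r * Q"
      using int[rule_format, OF ei] loop_moduleD(2)[OF V ei] loop_moduleD(2)[OF W ei] n by (intro inv) auto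
  qed (use n P Q PQ QP in auto)
qed

lemma iso_mod_trans:
  assumes U: "loop_module q U" and V: "loop_module q V" and W: "loop_module q W"
    and iso: "iso_mod U V" "iso_mod V W"
  shows "iso_mod U W"
proof -
  let ?n = "mdim U"
  obtain P Q where n: "mdim V = ?n"
    and P: "P \<in> carrier_mat ?n ?n" and Q: "Q \<in> carrier_mat ?n ?n"
    and PQ: "P * Q = 1\<^sub>m ?n" and QP: "Q * P = 1\<^sub>m ?n"
    and int: "\<forall>e\<in>signs. \<forall>i\<in>I0. \<forall>r.
      P * xop U e i r = xop V e i r * P \<and> P * psi U e i r = psi V e i r * P"
    using iso(1) by (rule iso_modE)
  obtain P' Q' where n': "mdim W = ?n"
    and P': "P' \<in> carrier_mat ?n ?n" and Q': "Q' \<in> carrier_mat ?n ?n"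
    and PQ': "P' * Q' = 1\<^sub>m ?n" and QP': "Q' * P' = 1\<^sub>m ?n"
    and int': "\<forall>e\<in>signs. \<forall>i\<in>I0. \<forall>r.
      P' * xop V e i r = xop W e i r * P' \<and> P' * psi V e i r = psi W e i r * P'"
    using iso(2) unfolding n[symmetric] by (rule iso_modE)
  note assoc = assoc_mult_mat[of _ ?n ?n _ ?n _ ?n]
  have comp: "(P' * P) * A = C * (P' * P)"
    if AB: "P * A = B * P" and BC: "P' * B = C * P'" and "A \<in> carrier_mat ?n ?n"
      "B \<in> carrier_mat ?n ?n" "C \<in> carrier_mat ?n ?n" for A B C
  proof -
    have "(P' * P) * A = P' * (P * A)" using that(3) P P' by (simp add: assoc)
    also have "\<dots> = (P' * B) * P" unfolding AB using that(4) P P' by (simp add: assoc)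
    also have "\<dots> = C * (P' * P)" unfolding BC using that(5) P P' by (simp add: assoc)
    finally show ?thesis .
  qed
  have "(P' * P) * (Q * Q') = P' * ((P * Q) * Q')" using P P' Q Q' by (simp add: assoc)
  then have inv1: "(P' * P) * (Q * Q') = 1\<^sub>m ?n" using PQ PQ' Q' by simp
  have "(Q * Q') * (P' * P) = Q * ((Q' * P') * P)" using P P' Q Q' by (simp add: assoc)
  then have inv2: "(Q * Q') * (P' * P) = 1\<^sub>m ?n" using QP QP' P by simp
  show ?thesis
  proof (rule iso_modI[of _ _ "P' * P" "Q * Q'"])
    fix e i r assume ei: "e \<in> signs" "i \<in> I0"
    show "P' * P * xop U e i r = xop W e i r * (P' * P)"
      using int[rule_format, OF ei] int'[rule_format, OF ei] loop_moduleD(1)[OF U ei] loop_moduleD(1)[OF V ei]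
        loop_moduleD(1)[OF W ei] n n' by (intro comp[of _ "xop V e i r"]) auto
    show "P' * P * psi U e i r = psi W e i r * (P' * P)"
      using int[rule_format, OF ei] int'[rule_format, OF ei] loop_moduleD(2)[OF U ei] loop_moduleD(2)[OF V ei]
        loop_moduleD(2)[OF W ei] n n' by (intro comp[of _ "psi V e i r"]) auto
  qed (use n' P P' Q Q' inv1 inv2 in auto)
qed

lemma iso_class_eqI:
  assumes "loop_module q V" "loop_module q W" "iso_mod V W"
  shows "iso_class q V = iso_class q W"
  unfolding iso_class_def using iso_mod_trans iso_mod_sym assms by blast

text \<open>
  An isomorphism maps a highest weight vector to a highest weight vector with the same eigenvalues.
\<close>

lemma has_drinfeld_polys_iso:
  assumes V: "loop_module q V" and W: "loop_module q W" and iso: "iso_mod V W"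
    and D: "has_drinfeld_polys q P V"
  shows "has_drinfeld_polys q P W"
proof -
  let ?n = "mdim V"
  obtain T Q where n: "mdim W = ?n"
    and T: "T \<in> carrier_mat ?n ?n" and Q: "Q \<in> carrier_mat ?n ?n"
    and "T * Q = 1\<^sub>m ?n" and QT: "Q * T = 1\<^sub>m ?n"
    and int: "\<forall>e\<in>signs. \<forall>i\<in>I0. \<forall>r.
      T * xop V e i r = xop W e i r * T \<and> T * psi V e i r = psi W e i r * T"
    using iso by (rule iso_modE)
  obtain v \<kappa> where v: "v \<in> carrier_vec ?n" "v \<noteq> 0\<^sub>v ?n"
    and hw: "\<forall>i\<in>I0. \<forall>r. xop V 1 i r *\<^sub>v v = 0\<^sub>v ?n"
    and psi: "\<forall>e\<in>signs. \<forall>i\<in>I0. \<forall>r. psi V e i r *\<^sub>v v = \<kappa> e i r \<cdot>\<^sub>v v"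
    and \<kappa>: "\<forall>e\<in>signs. \<forall>i\<in>I0. \<forall>m.
          (\<Sum>n\<le>degree (P i). coeff (P i) n * q ^ n * \<kappa> e i (m - int n))
          = q ^ degree (P i) * (if 0 \<le> m then coeff (P i) (nat m) * q powi (- m) else 0)"
    using D unfolding has_drinfeld_polys_def by blast
  have apply_int: "B *\<^sub>v (T *\<^sub>v v) = T *\<^sub>v (A *\<^sub>v v)"
    if "T * A = B * T" "A \<in> carrier_mat ?n ?n" "B \<in> carrier_mat ?n ?n" for A B
  proof -
    have "B *\<^sub>v (T *\<^sub>v v) = (B * T) *\<^sub>v v"
      using that(3) T v(1) by (simp add: assoc_mult_mat_vec[of _ ?n ?n _ ?n])
    also have "\<dots> = T *\<^sub>v (A *\<^sub>v v)"
      unfolding that(1)[symmetric] using that(2) T v(1)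
      by (simp add: assoc_mult_mat_vec[of _ ?n ?n _ ?n])
    finally show ?thesis .
  qed
  have s: "1 \<in> signs" by (simp add: signs_def)
  show ?thesis
    unfolding has_drinfeld_polys_def n
  proof (intro bexI[of _ "T *\<^sub>v v"] conjI exI[of _ \<kappa>] ballI allI)
    show "T *\<^sub>v v \<noteq> 0\<^sub>v ?n"
    proof
      assume 0: "T *\<^sub>v v = 0\<^sub>v ?n"
      have "v = (Q * T) *\<^sub>v v" unfolding QT using v(1) by simp
      also have "\<dots> = Q *\<^sub>v (T *\<^sub>v v)"
        using Q T v(1) by (simp add: assoc_mult_mat_vec[of _ ?n ?n _ ?n])
      also have "\<dots> = 0\<^sub>v ?n" unfolding 0 by (rule mat_zero_vec[OF Q])
      finally show False using v(2) by simp
    qed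
  next
    fix i r assume i: "i \<in> I0"
    have "xop W 1 i r *\<^sub>v (T *\<^sub>v v) = T *\<^sub>v (xop V 1 i r *\<^sub>v v)"
      using int[rule_format, OF s i] loop_moduleD(1)[OF V s i] loop_moduleD(1)[OF W s i] n
      by (intro apply_int) auto
    then show "xop W 1 i r *\<^sub>v (T *\<^sub>v v) = 0\<^sub>v ?n"
      using hw i mat_zero_vec[OF T] by simp
  next
    fix e i r assume ei: "e \<in> signs" "i \<in> I0"
    have "psi W e i r *\<^sub>v (T *\<^sub>v v) = T *\<^sub>v (psi V e i r *\<^sub>v v)"
      using int[rule_format, OF ei] loop_moduleD(2)[OF V ei] loop_moduleD(2)[OF W ei] n
      by (intro apply_int) auto
    then show "psi W e i r *\<^sub>v (T *\<^sub>v v) = \<kappa> e i r \<cdot>\<^sub>v (T *\<^sub>v v)"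
      using psi ei T v(1) by (simp add: mult_mat_vec)
  next
    fix e i m assume "e \<in> signs" "i \<in> I0"
    then show "(\<Sum>n\<le>degree (P i). coeff (P i) n * q ^ n * \<kappa> e i (m - int n))
          = q ^ degree (P i) * (if 0 \<le> m then coeff (P i) (nat m) * q powi (- m) else 0)"
      using \<kappa> by blast
  qed (use T v(1) in auto)
qed

lemma has_drinfeld_polysE:
  assumes "loop_module q V" "q \<noteq> 0" "\<And>n. n > 0 \<Longrightarrow> q ^ n \<noteq> 1" "has_drinfeld_polys q P V"
  obtains v \<kappa> where "hw_rep q V v \<kappa>"
    "\<And>e i. e \<in> signs \<Longrightarrow> i \<in> I0 \<Longrightarrow> series_of_poly q (P i) (\<kappa> e i)"
proof -
  obtain v \<kappa> where "v \<in> carrier_vec (mdim V)" "v \<noteq> 0\<^sub>v (mdim V)"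
    "\<forall>i\<in>I0. \<forall>r. xop V 1 i r *\<^sub>v v = 0\<^sub>v (mdim V)"
    "\<forall>e\<in>signs. \<forall>i\<in>I0. \<forall>r. psi V e i r *\<^sub>v v = \<kappa> e i r \<cdot>\<^sub>v v"
    and \<kappa>: "\<forall>e\<in>signs. \<forall>i\<in>I0. \<forall>m.
          (\<Sum>n\<le>degree (P i). coeff (P i) n * q ^ n * \<kappa> e i (m - int n))
          = q ^ degree (P i) * (if 0 \<le> m then coeff (P i) (nat m) * q powi (- m) else 0)"
    using assms(4) unfolding has_drinfeld_polys_def by blast
  then have "hw_rep q V v \<kappa>" using assms by unfold_locales auto
  moreover have "series_of_poly q (P i) (\<kappa> e i)" if "e \<in> signs" "i \<in> I0" for e i
    using \<kappa> that unfolding series_of_poly_def by blast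
  ultimately show thesis by (rule that)
qed

text \<open>
  The Drinfeld polynomials determine all eigenvalues on the highest weight vector.
\<close>

lemma is_V_unique:
  fixes q :: "'k::field_char_0"
  assumes q: "q \<noteq> 0" "\<And>n. n > 0 \<Longrightarrow> q ^ n \<noteq> 1"
    and V: "is_V q M V" and W: "is_V q M W"
  shows "iso_mod V W"
proof -
  have D: "loop_module q U" "simple_module U" "has_drinfeld_polys q (drinfeld_poly q M) U"
    if "is_V q M U" for U using that by (auto simp: is_V_def)
  obtain v \<kappa> where v: "hw_rep q V v \<kappa>"
    and \<kappa>: "\<And>e i. e \<in> signs \<Longrightarrow> i \<in> I0 \<Longrightarrow> series_of_poly q (drinfeld_poly q M i) (\<kappa> e i)"
    using has_drinfeld_polysE[OF D(1)[OF V] q D(3)[OF V]] by blast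
  obtain w \<mu> where w: "hw_rep q W w \<mu>"
    and \<mu>: "\<And>e i. e \<in> signs \<Longrightarrow> i \<in> I0 \<Longrightarrow> series_of_poly q (drinfeld_poly q M i) (\<mu> e i)"
    using has_drinfeld_polysE[OF D(1)[OF W] q D(3)[OF W]] by blast
  have eq: "\<kappa> e i = \<mu> e i" if ei: "e \<in> signs" "i \<in> I0" for e i
  proof (cases "e = 1")
    case True
    show ?thesis
      by (rule poly_determines_series_plus[OF coeff_0_drinfeld_poly \<kappa>[OF ei] \<mu>[OF ei]])
        (use hw_rep.eigenvalue_vanishes[OF v ei] hw_rep.eigenvalue_vanishes[OF w ei] True in auto)
  next
    case False
    then have e: "e = - 1" using ei by (auto simp: signs_def)
    have "drinfeld_poly q M i \<noteq> 0" using coeff_0_drinfeld_poly[of q M i] by auto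
    from poly_determines_series_minus[OF q(1) this \<kappa>[OF ei] \<mu>[OF ei]]
    show ?thesis
      using hw_rep.eigenvalue_vanishes[OF v ei] hw_rep.eigenvalue_vanishes[OF w ei] e by auto
  qed
  interpret W: hw_rep q W w \<mu> by (rule w)
  have "hw_rep q W w \<kappa>"
    by unfold_locales (simp_all add: W.v W.v_nonzero W.hw W.psi_v eq)
  from iso_of_common_highest_weight[OF v D(2)[OF V] this D(2)[OF W]] show ?thesis .
qed

text \<open>
  The eigenvalues on the highest weight vector are those of either monomial, and they determine the
  polynomials; the expansion at \<open>0\<close> is enough for this.
\<close>

lemma drinfeld_monomial_unique:
  fixes q :: "'k::field"
  assumes q: "q \<noteq> 0" "\<And>n. n > 0 \<Longrightarrow> q ^ n \<noteq> 1"
    and V: "loop_module q V" "simple_module V"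
    and D: "has_drinfeld_polys q (drinfeld_poly q M) V" "has_drinfeld_polys q (drinfeld_poly q M') V"
    and keys: "Poly_Mapping.keys M \<subseteq> S_Z" "Poly_Mapping.keys M' \<subseteq> S_Z"
  shows "M = M'"
proof (rule drinfeld_poly_inj[OF q keys])
  fix i assume i: "i \<in> I0"
  have s: "1 \<in> signs" by (simp add: signs_def)
  obtain v \<kappa> where v: "hw_rep q V v \<kappa>"
    and \<kappa>: "\<And>e i. e \<in> signs \<Longrightarrow> i \<in> I0 \<Longrightarrow> series_of_poly q (drinfeld_poly q M i) (\<kappa> e i)"
    using has_drinfeld_polysE[OF V(1) q D(1)] by blast
  obtain w \<mu> where w: "hw_rep q V w \<mu>"
    and \<mu>: "\<And>e i. e \<in> signs \<Longrightarrow> i \<in> I0 \<Longrightarrow> series_of_poly q (drinfeld_poly q M' i) (\<mu> e i)"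
    using has_drinfeld_polysE[OF V(1) q D(2)] by blast
  have "\<mu> 1 i = \<kappa> 1 i" by (rule hw_rep.highest_weight_unique[OF v V(2) w s i])
  then show "drinfeld_poly q M i = drinfeld_poly q M' i"
    using series_determines_poly[OF q \<kappa>[OF s i] coeff_0_drinfeld_poly _ coeff_0_drinfeld_poly]
      \<mu>[OF s i] hw_rep.eigenvalue_vanishes[OF v s i] by simp
qed

lemma V_class_eq_iso_class:
  fixes q :: "'k::field_char_0"
  assumes q: "q \<noteq> 0" "\<And>n. n > 0 \<Longrightarrow> q ^ n \<noteq> 1" and V: "is_V q M V"
  shows "V_class q M = iso_class q V"
proof -
  have "iso_class q W = iso_class q V" if "is_V q M W" for W
    using iso_class_eqI[of q W V] is_V_unique[OF q that V] that V by (simp add: is_V_def)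
  then show ?thesis unfolding V_class_def using V by blast
qed

lemma V_class_monomial_unique:
  fixes q :: "'k::field"
  assumes q: "q \<noteq> 0" "\<And>n. n > 0 \<Longrightarrow> q ^ n \<noteq> 1"
    and V: "is_V q M V" and eq: "V_class q M' = iso_class q V"
    and keys: "Poly_Mapping.keys M \<subseteq> S_Z" "Poly_Mapping.keys M' \<subseteq> S_Z"
  shows "M' = M"
proof -
  have V': "loop_module q V" "simple_module V" "has_drinfeld_polys q (drinfeld_poly q M) V"
    using V by (auto simp: is_V_def)
  have "V \<in> V_class q M'"
    unfolding eq iso_class_def using V'(1) iso_mod_refl by blast
  then obtain W where W: "is_V q M' W" "iso_mod W V"
    unfolding V_class_def iso_class_def by blast
  then have "has_drinfeld_polys q (drinfeld_poly q M') V"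
    using has_drinfeld_polys_iso[OF _ V'(1) W(2)] by (simp add: is_V_def)
  from drinfeld_monomial_unique[OF q V'(1,2) this V'(3) keys(2,1)] show ?thesis .
qed

section \<open>The action of the reflections on simple modules\<close>

text \<open>
  The preimage under \<open>\<phi>\<close> that occurs in the definition of the reflection is only some preimage; by uniqueness
  of the monomial it is the family of the triples \<open>(a\<^sub>k, b\<^sub>k, c\<^sub>k)\<close>.
\<close>

theorem proposition6p2:
  fixes q :: "'k :: {alg_closed_field, field_char_0}"
    and a b c :: "int \<Rightarrow> nat"
    and V :: "'k loop_mod"
  defines "M \<equiv> Y_product a b c"
    and "M' \<equiv> Y_product
      (\<lambda>k. min (a k) (c k))
      (\<lambda>k. b k + nat (max (int (a k) - int (c k)) 0))
      (\<lambda>k. b (k - 1) + nat (max (int (c (k - 1)) - int (a (k - 1))) 0))"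
    and "M'' \<equiv> Y_product
      (\<lambda>k. a (k - 1) + c k - min (a (k - 1)) (b k))
      (\<lambda>k. min (a (k - 1)) (b k))
      (\<lambda>k. b k + c k - min (a (k - 1)) (b k))"
  assumes q: "q \<noteq> 0" "\<And>n. n > 0 \<Longrightarrow> q ^ n \<noteq> 1"
    and finite_support: "finite {k. a k \<noteq> 0 \<or> b k \<noteq> 0 \<or> c k \<noteq> 0}"
    and V: "is_V q M V"
  shows "R_refl q 1 (iso_class q V) = V_class q M'
       \<and> R_refl q 2 (iso_class q V) = V_class q M''"
proof -
  define m where "m = (\<lambda>k. (a k, b k, c k))"
  have m_hat: "m \<in> MS_hat" using finite_support by (simp add: MS_hat_def m_def)
  have m_M: "ms_monomial m = M" by (simp add: ms_monomial_def m_def M_def)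
  have keys_hat: "Poly_Mapping.keys (ms_monomial l) \<subseteq> S_Z" if "l \<in> MS_hat" for l
  proof -
    have "finite {k. fst (l k) \<noteq> 0 \<or> fst (snd (l k)) \<noteq> 0 \<or> snd (snd (l k)) \<noteq> 0}"
      by (rule finite_subset[of _ "{k. l k \<noteq> (0, 0, 0)}"]) (use that in \<open>auto simp: MS_hat_def\<close>)
    then show ?thesis unfolding ms_monomial_def by (rule keys_Y_product)
  qed
  have keys: "Poly_Mapping.keys M \<subseteq> S_Z" using keys_hat[OF m_hat] by (simp add: m_M)
  have m_class: "phi_iso q m = iso_class q V"
    unfolding phi_iso_def m_M by (rule V_class_eq_iso_class[OF q V])
  define l where "l = inv_into MS_hat (phi_iso q) (iso_class q V)"
  have im: "iso_class q V \<in> phi_iso q ` MS_hat" using m_class m_hat by (metis imageI)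
  have l: "l \<in> MS_hat" "phi_iso q l = iso_class q V"
    unfolding l_def using inv_into_into[OF im] f_inv_into_f[OF im] by auto
  have "ms_monomial l = M"
    using V_class_monomial_unique[OF q V _ keys keys_hat[OF l(1)]] l(2) by (simp add: phi_iso_def)
  then have "l = m" using ms_monomial_inj[OF l(1) m_hat] m_M by simp
  moreover have "iso_class q V \<in> B_g q" unfolding B_g_def using V keys by blast
  ultimately have R: "R_refl q i (iso_class q V) = V_class q (ms_monomial (R_op i m))" for i
    by (simp add: R_refl_def l_def phi_iso_def)
  show ?thesis
    unfolding R m_def R_op_1 R_op_2 by (simp add: ms_monomial_def M'_def M''_def)
qed

end
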